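(* For all $n \geq 0$, $$p_{\xi}(3n) \equiv \begin{cases} 1 \pmod{4}, & \text{if } n=0,\\ 2 \pmod{4}, & \text{if } n \text{ is a (positive) square},\\ 0 \pmod{4}, & \text{otherwise}.\end{cases}$$
   Context: $(a;q)_n=(1-a)(1-aq)\cdots(1-aq^{n-1})$, $(a;q)_0=1$. The coefficients $p_\xi(n)$ are defined by $\sum_{n\ge0}p_\xi(n)q^n=\xi(q)=1+2\sum_{n\ge1}\frac{q^{6n^2-6n+1}}{(q;q^6)_n(q^5;q^6)_n}$. *)

theory Defs
  imports "HOL-Computational_Algebra.Formal_Power_Series" "HOL-Number_Theory.Cong"
begin

definition qpoch :: "'a::comm_ring_1 \<Rightarrow> 'a \<Rightarrow> nat \<Rightarrow> 'a" where
  "qpoch a q n = (\<Prod>k<n. 1 - a * q ^ k)"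

text \<open>Everything takes place in the ring of formal power series over the integers. Since the
  integers are not a field, the denominator, whose constant coefficient is 1, is inverted by
  \<^term>\<open>\<lambda>f. fps_left_inverse f 1\<close>; see \<open>xi_denom_inverse\<close> below.\<close>

definition xi_denom :: "nat \<Rightarrow> int fps" where
  "xi_denom n = qpoch fps_X (fps_X ^ 6) n * qpoch (fps_X ^ 5) (fps_X ^ 6) n"

text \<open>Truncated subtraction on \<^typ>\<open>nat\<close> is harmless here because
  \<open>6 * n\<^sup>2 \<ge> 6 * n\<close>.\<close>

definition xi_term :: "nat \<Rightarrow> int fps" where
  "xi_term n = fps_X ^ (6 * n\<^sup>2 - 6 * n + 1) * fps_left_inverse (xi_denom n) 1"

text \<open>The infinite sum is the limit of the partial sums in the \<open>fps_X\<close>-adic metric of the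
  library; it converges by \<open>summable_xi_term\<close> below. The index is shifted so that the sum runs
  over \<open>n \<ge> 1\<close>.\<close>

definition xi :: "int fps" where
  "xi = 1 + 2 * (\<Sum>n. xi_term (Suc n))"

definition p_xi :: "nat \<Rightarrow> int" where
  "p_xi n = fps_nth xi n"

lemma xi_denom_inverse: "xi_denom n * fps_left_inverse (xi_denom n) 1 = 1"
proof -
  have "fps_nth (\<Prod>k<n. 1 - fps_X ^ Suc j * (fps_X ^ 6) ^ k) 0 = (1::int)" for j
    by (induction n) simp_all
  from this[of 0] this[of 4] have "fps_nth (xi_denom n) 0 = 1"
    by (simp add: xi_denom_def qpoch_def)
  then show ?thesis
    by (subst mult.commute) (rule fps_left_inverse, simp)
qed

lemma summable_xi_term: "summable (\<lambda>n. xi_term (Suc n))"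
proof -
  have z: "fps_nth (xi_term (Suc n)) k = 0" if "k \<le> n" for n k
  proof -
    have "k < 6 * (Suc n)\<^sup>2 - 6 * Suc n + 1"
      using that by (simp add: power2_eq_square)
    then show ?thesis
      unfolding xi_term_def by (subst fps_X_power_mult_nth) simp
  qed
  have "(\<lambda>n. \<Sum>i<n. xi_term (Suc i)) \<longlonglongrightarrow>
      Abs_fps (\<lambda>k. \<Sum>i<k. fps_nth (xi_term (Suc i)) k)"
  proof (rule tendsto_fpsI)
    fix k
    show "\<forall>\<^sub>F n in sequentially. fps_nth (\<Sum>i<n. xi_term (Suc i)) k =
        fps_nth (Abs_fps (\<lambda>k. \<Sum>i<k. fps_nth (xi_term (Suc i)) k)) k"
      using eventually_ge_at_top[of k]
    proof eventually_elim
      case (elim n)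
      have "(\<Sum>i<n. fps_nth (xi_term (Suc i)) k) = (\<Sum>i<k. fps_nth (xi_term (Suc i)) k)"
        using elim z by (intro sum.mono_neutral_right) auto
      then show ?case by (simp add: fps_sum_nth)
    qed
  qed
  then show ?thesis by (auto simp: summable_def sums_def)
qed

end

theory Submission
  imports Defs "HOL-Number_Theory.Number_Theory" "HOL-Library.Discrete_Functions"
begin

text \<open>
  Modulo 4 only the parity of the coefficients of $(\xi(q)-1)/2$ matters. Writing
  $Q = q^6$, Bailey's lemma applied to the partial fraction expansion of
  $1/((q;Q)_{n+1} (q^5;Q)_{n+1})$ turns this series into $1/(Q;Q)_\infty$ times a Lambert series in
  which the exponents divisible by 3 can be read off. The coefficient of $q^N$ in the resulting
  series counts, up to signs, the divisors $d < \sqrt m$ of $m = 12N+1$ (and $d = \sqrt m$ if it is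
  $5$ modulo $6$). On the other
  hand, by Euler's pentagonal number theorem, the product of $(q^2;q^2)_\infty$ with
  $\sum_{n \ge 1} q^{n^2}$ counts, up to signs, the solutions of $x^2 + 12 n^2 = m$ in positive
  integers. The two counts have the same parity because the number of representations of $m$ by
  $x^2 + 3 z^2$ is $2 \sum_{d \mid m} (\frac{-3}{d})$.
\<close>

section \<open>Bailey's lemma\<close>

text \<open>Trisection is what brings in Euler's product: (q^6;q^6)_inf is a series in q^3, so its
  reciprocal leaves the trisection as 1/(q^2;q^2)_inf. Multiplication by that integral series
  preserves evenness of coefficients, so it suffices to compare the trisected Lambert series with
  (q^2;q^2)_inf times the series of squares modulo 2, where every sign (-1)^r disappears. The number
  12N+1 comes from completing squares: 12(3r^2+r)+1 = (6r+1)^2 and 12(3r^2+5r+2)+1 = (6r+5)^2. The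
  odd rule for the square root of m reflects an exact identity: the positive solutions of x^2+12n^2
  = m are as many as the divisors d = 1 mod 6 with d^2 < m, minus the divisors d = 5 mod 6 with d^2
  \<le> m. Infinite products are never formed. Their identities are congruences modulo Q^K between
  finite sums, with \<open>i K\<close> standing for 1/(Q;Q)_inf. The abstract Q is used at q^6 for
  the mock theta function and at q^2 for the pentagonal number theorem.\<close>

text \<open>The element \<open>i n\<close> plays the role of $1/(Q;Q)_n$.\<close>

locale q_inverses =
  fixes Q :: "'a::comm_ring_1" and i :: "nat \<Rightarrow> 'a"
  assumes i_0 [simp]: "i 0 = 1"
    and i_step: "(1 - Q ^ Suc n) * i (Suc n) = i n"
begin

lemma i_unit: "(\<Prod>k<n. 1 - Q ^ Suc k) * i n = 1"
proof (induction n)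
  case (Suc n)
  then show ?case
    using i_step[of n] by (simp only: prod.lessThan_Suc mult.assoc)
qed simp

lemma i_cancel: "i n * a = i n * b \<Longrightarrow> a = b"
  by (metis i_unit mult.assoc mult_1)

text \<open>For n > 0 the element \<open>1 - Q ^ n\<close> is a factor of the product inverted by
  \<open>i n\<close>, hence a unit even if the ring has zero divisors. Several identities below are
  proved only after multiplication by such a factor.\<close>

lemma cancel:
  assumes "n > 0" and eq: "(1 - Q ^ n) * a = (1 - Q ^ n) * b"
  shows "a = b"
proof -
  obtain k where k: "n = Suc k"
    using assms(1) gr0_implies_Suc by blast
  have "i k * a = i (Suc k) * ((1 - Q ^ n) * a)"
    unfolding i_step[of k, symmetric] k by (simp only: ac_simps)
  also have "\<dots> = i k * b"
    unfolding i_step[of k, symmetric] k eq[unfolded k] by (simp only: ac_simps)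
  finally show ?thesis by (rule i_cancel)
qed

text \<open>A finite form of Durfee's rectangle identity, equivalent to a $q$-Vandermonde sum.\<close>

lemma durfee_sum:
  "(\<Sum>m\<le>A. Q ^ (m * (m + k)) * i m * i (A - m) * i (m + k)) = i A * i (A + k)"
proof (induction A arbitrary: k)
  case (Suc A)
  let ?t = "\<lambda>m. Q ^ (m * (m + k)) * i m * i (Suc A - m) * i (m + k)"
  let ?u = "\<lambda>m. Q ^ (m * (m + k) + m) * i m * i (A - m) * i (m + k)"
  let ?v = "\<lambda>m. Q ^ (Suc m * (Suc m + k)) * i m * i (A - m) * i (Suc m + k)"
  let ?w = "\<lambda>m. Q ^ (m * (m + Suc k)) * i m * i (A - m) * i (m + Suc k)"
  have 1: "(1 - Q ^ (Suc A - m)) * Q ^ m * ?t m = ?u m" if "m \<le> A" for m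
    unfolding Suc_diff_le[OF that] i_step[of "A - m", symmetric] power_add
    by (simp only: ac_simps)
  have 2: "(1 - Q ^ Suc m) * ?t (Suc m) = ?v m" for m
    unfolding i_step[of m, symmetric] diff_Suc_Suc by (simp only: ac_simps)
  have 3: "?u m + ?v m = ?w m" if "m \<le> A" for m
  proof -
    have "Q ^ (Suc m * (Suc m + k)) = Q ^ (m * (m + k)) * Q ^ m * Q ^ (Suc (m + k))"
         "Q ^ (m * (m + Suc k)) = Q ^ (m * (m + k)) * Q ^ m"
         "Q ^ (m * (m + k) + m) = Q ^ (m * (m + k)) * Q ^ m"
      by (simp_all flip: power_add add: algebra_simps)
    moreover have "i (m + k) = (1 - Q ^ Suc (m + k)) * i (m + Suc k)"
      using i_step[of "m + k"] by simp
    moreover have "a * b * u * v * ((1 - c) * w) + a * b * c * u * v * w = a * b * u * v * w"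
      for a b c u v w :: 'a
      by (simp add: algebra_simps)
    ultimately show ?thesis
      by (simp only: add_Suc add_Suc_right)
  qed
  \<comment> \<open>The factor is split as (1 - Q^(A+1-m)) Q^m + (1 - Q^m). The first part lowers
    the index of \<open>i (Suc A - m)\<close>, the second that of \<open>i m\<close>; after a shift
    of m the two sums merge into the instance of the induction hypothesis with k + 1.\<close>
  have "(1 - Q ^ Suc A) * (\<Sum>m\<le>Suc A. ?t m) =
      (\<Sum>m\<le>Suc A. (1 - Q ^ (Suc A - m)) * Q ^ m * ?t m + (1 - Q ^ m) * ?t m)"
    unfolding sum_distrib_left
  proof (rule sum.cong[OF refl])
    fix m assume "m \<in> {..Suc A}"
    then have "Q ^ Suc A = Q ^ (Suc A - m) * Q ^ m"
      by (simp flip: power_add)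
    then show "(1 - Q ^ Suc A) * ?t m = (1 - Q ^ (Suc A - m)) * Q ^ m * ?t m + (1 - Q ^ m) * ?t m"
      by (simp only: left_diff_distrib mult_1 mult.assoc) simp
  qed
  also have "\<dots> = (\<Sum>m\<le>Suc A. (1 - Q ^ (Suc A - m)) * Q ^ m * ?t m) + (\<Sum>m\<le>Suc A. (1 - Q ^ m) * ?t m)"
    by (rule sum.distrib)
  also have "(\<Sum>m\<le>Suc A. (1 - Q ^ (Suc A - m)) * Q ^ m * ?t m) = (\<Sum>m\<le>A. ?u m)"
    by (subst sum.atMost_Suc) (use 1 in \<open>auto intro!: sum.cong\<close>)
  also have "(\<Sum>m\<le>Suc A. (1 - Q ^ m) * ?t m) = (\<Sum>m\<le>A. ?v m)"
    by (subst sum.atMost_Suc_shift) (simp only: 2 power_0 diff_self mult_zero_left add_0)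
  also have "(\<Sum>m\<le>A. ?u m) + (\<Sum>m\<le>A. ?v m) = (\<Sum>m\<le>A. ?w m)"
    unfolding sum.distrib[symmetric] by (rule sum.cong) (use 3 in auto)
  also have "\<dots> = i A * i (A + Suc k)" by (rule Suc.IH)
  also have "\<dots> = (1 - Q ^ Suc A) * (i (Suc A) * i (Suc A + k))"
    unfolding i_step[of A, symmetric] by (simp add: mult.assoc)
  finally show ?case by (rule cancel[rotated]) simp
qed simp

text \<open>The second member of a Bailey pair relative to a = Q. Usually the denominator is
  (Q;Q)_(n-r) (Q^2;Q)_(n+r); using (Q;Q)_(n+r+1) instead moves a factor 1 - Q into \<alpha> and
  leaves only values of \<open>i\<close>.\<close>

definition bailey :: "(nat \<Rightarrow> 'a) \<Rightarrow> nat \<Rightarrow> 'a" where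
  "bailey \<alpha> n = (\<Sum>r\<le>n. \<alpha> r * i (n - r) * i (n + r + 1))"

text \<open>After interchanging the sums and putting n = m + r, the inner sum is
  \<open>durfee_sum\<close> with A - r for A and k = 2r + 1, because (m+r)^2 + (m+r) = (r^2+r) +
  m(m+2r+1). This is the case of Bailey's lemma in which both free parameters tend to
  infinity.\<close>

lemma bailey_lemma:
  "(\<Sum>n\<le>A. Q ^ (n\<^sup>2 + n) * bailey \<alpha> n * i (A - n)) =
   (\<Sum>r\<le>A. Q ^ (r\<^sup>2 + r) * \<alpha> r * i (A - r) * i (A + r + 1))"
proof -
  let ?f = "\<lambda>n r. Q ^ (n\<^sup>2 + n) * (\<alpha> r * i (n - r) * i (n + r + 1)) * i (A - n)"
  have "(\<Sum>n\<le>A. Q ^ (n\<^sup>2 + n) * bailey \<alpha> n * i (A - n)) = (\<Sum>n\<le>A. \<Sum>r\<le>n. ?f n r)"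
    by (simp add: bailey_def sum_distrib_left sum_distrib_right)
  also have "\<dots> = (\<Sum>r\<le>A. \<Sum>n = r..A. ?f n r)"
    unfolding sum.Sigma[OF finite_atMost ballI[OF finite_atMost]] sum.Sigma[OF finite_atMost ballI[OF finite_atLeastAtMost]]
    by (rule sum.reindex_bij_witness[of _ "\<lambda>(r, n). (n, r)" "\<lambda>(n, r). (r, n)"]) auto
  also have "\<dots> = (\<Sum>r\<le>A. Q ^ (r\<^sup>2 + r) * \<alpha> r * i (A - r) * i (A + r + 1))"
  proof (rule sum.cong[OF refl])
    fix r assume r: "r \<in> {..A}"
    have "(\<Sum>n = r..A. ?f n r) = (\<Sum>m\<le>A - r. ?f (m + r) r)"
      using r by (intro sum.reindex_bij_witness[of _ "\<lambda>m. m + r" "\<lambda>n. n - r"]) auto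
    also have "\<dots> = Q ^ (r\<^sup>2 + r) * \<alpha> r *
        (\<Sum>m\<le>A - r. Q ^ (m * (m + (2 * r + 1))) * i m * i (A - r - m) * i (m + (2 * r + 1)))"
      unfolding sum_distrib_left
    proof (rule sum.cong[OF refl])
      fix m
      have "(m + r)\<^sup>2 + (m + r) = (r\<^sup>2 + r) + m * (m + (2 * r + 1))"
        by (simp add: power2_eq_square algebra_simps)
      then have *: "Q ^ ((m + r)\<^sup>2 + (m + r)) = Q ^ (r\<^sup>2 + r) * Q ^ (m * (m + (2 * r + 1)))"
        by (simp only: power_add)
      have **: "m + r + r + 1 = m + (2 * r + 1)" "A - (m + r) = A - r - m" "m + r - r = m" by simp_all
      show "?f (m + r) r = Q ^ (r\<^sup>2 + r) * \<alpha> r *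
        (Q ^ (m * (m + (2 * r + 1))) * i m * i (A - r - m) * i (m + (2 * r + 1)))"
        unfolding * ** by (simp only: ac_simps)
    qed
    also have "\<dots> = Q ^ (r\<^sup>2 + r) * \<alpha> r * (i (A - r) * i (A - r + (2 * r + 1)))"
      by (subst durfee_sum) simp
    also have "A - r + (2 * r + 1) = A + r + 1" using r by simp
    finally show "(\<Sum>n = r..A. ?f n r) = Q ^ (r\<^sup>2 + r) * \<alpha> r * i (A - r) * i (A + r + 1)"
      by (simp only: ac_simps)
  qed
  finally show ?thesis .
qed

text \<open>The unit Bailey pair. It serves twice: it kills the correction term in
  \<open>bailey_partial_fractions\<close>, and fed into \<open>bailey_limit\<close> it yields
  Euler's pentagonal number theorem.\<close>

lemma bailey_unit:
  "bailey (\<lambda>r. (-1) ^ r * Q ^ (r choose 2) * (1 - Q ^ (2 * r + 1))) n = (if n = 0 then 1 else 0)"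
proof (cases "n = 0")
  case True
  then show ?thesis using i_step[of 0] by (simp add: bailey_def numeral_2_eq_2)
next
  case False
  define t where "t = (\<lambda>r. (-1) ^ r * Q ^ (r choose 2) * (1 - Q ^ (2 * r + 1)) * i (n - r) * i (n + r + 1))"
  \<comment> \<open>The partial sums have a closed form after multiplication by \<open>1 - Q ^ n\<close>.\<close>
  have tel: "(1 - Q ^ n) * (\<Sum>r<R. t r) =
      - ((-1) ^ R * Q ^ (R choose 2) * (1 - Q ^ R) * i (n - R) * i (n + R))" if "R \<le> n" for R
    using that
  proof (induction R)
    case (Suc R)
    \<comment> \<open>With n = R + s + 1 all powers become monomials in Q, Q^R and Q^s, so the
      induction step is a polynomial identity.\<close>
    obtain s where s: "n = Suc (R + s)"
      using Suc.prems less_iff_Suc_add by (metis Suc_le_eq)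
    have c: "Q ^ (Suc R choose 2) = Q ^ R * Q ^ (R choose 2)"
      by (simp add: numeral_2_eq_2 power_add)
    have e: "n - R = Suc s" "n - Suc R = s" "n + Suc R = Suc (n + R)" "n + R + 1 = Suc (n + R)"
      using s by simp_all
    have q: "Q ^ n = Q * Q ^ R * Q ^ s" "Q ^ Suc s = Q * Q ^ s" "Q ^ Suc (n + R) = Q ^ 2 * Q ^ R * Q ^ R * Q ^ s"
       "Q ^ Suc R = Q * Q ^ R" "Q ^ (2 * R + 1) = Q * (Q ^ R * Q ^ R)" "(-1) ^ Suc R = - ((-1::'a) ^ R)"
      by (simp_all add: s power_add power2_eq_square mult_2 mult_2_right ac_simps)
    have i1: "i s = (1 - Q * Q ^ s) * i (Suc s)"
      using i_step[of s] by simp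
    have i2: "i (n + R) = (1 - Q ^ 2 * Q ^ R * Q ^ R * Q ^ s) * i (Suc (n + R))"
      using i_step[of "n + R"] unfolding q by simp
    have "(1 - Q ^ n) * (\<Sum>r<Suc R. t r) =
       - ((-1) ^ R * Q ^ (R choose 2) * (1 - Q ^ R) * i (n - R) * i (n + R)) + (1 - Q ^ n) * t R"
      using Suc by (simp add: distrib_left)
    also have "\<dots> = - ((-1) ^ Suc R * Q ^ (Suc R choose 2) * (1 - Q ^ Suc R) * i (n - Suc R) * i (n + Suc R))"
      unfolding t_def c e q i1 i2 by (simp add: algebra_simps power2_eq_square)
    finally show ?case .
  qed simp
  \<comment> \<open>The closed form at R = n is exactly the negative of the last summand times
    \<open>1 - Q ^ n\<close>.\<close>
  have "(1 - Q ^ n) * (\<Sum>r\<le>n. t r) = (1 - Q ^ n) * (\<Sum>r<n. t r) + (1 - Q ^ n) * t n"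
    by (simp add: lessThan_Suc_atMost[symmetric] distrib_left)
  also have "\<dots> = (1 - Q ^ n) * 0"
  proof -
    have "(1 - Q ^ (2 * n + 1)) * i (n + n + 1) = i (n + n)"
      using i_step[of "n + n"] by (simp add: mult_2)
    then have "t n = (-1) ^ n * Q ^ (n choose 2) * i (n + n)"
      by (simp add: t_def mult.assoc)
    then show ?thesis
      unfolding tel[OF order_refl] by (simp add: algebra_simps)
  qed
  finally have "(\<Sum>r\<le>n. t r) = 0"
    by (rule cancel[rotated]) (use False in simp)
  then show ?thesis using False by (simp add: bailey_def t_def)
qed

text \<open>Multiplication by (1 - xQ^N)(1 - yQ^N) at N = n + 1 turns the sum for N into the sum for
  n, up to a multiple of the unit pair, which vanishes for N > 0. The exponent
  \<open>Suc r choose 2\<close> exceeds \<open>r choose 2\<close> by r, so that Q^(N-r) becomes the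
  constant Q^N and leaves the sum.\<close>

lemma bailey_partial_fractions:
  assumes xy: "x * y = Q" and p: "\<And>r. (1 - x * Q ^ r) * (1 - y * Q ^ r) * p r = 1"
  shows "bailey (\<lambda>r. (-1) ^ r * Q ^ (Suc r choose 2) * (1 - Q ^ (2 * r + 1)) * p r) n = (\<Prod>k\<le>n. p k)"
proof (induction n)
  case 0
  have "(1 - Q) * i 1 = 1" using i_step[of 0] by simp
  moreover have "p 0 * (1 - x) * (1 - y) = 1" using p[of 0] by (simp add: ac_simps)
  ultimately show ?case by (simp add: bailey_def numeral_2_eq_2 mult.assoc mult.commute[of _ "p 0"])
next
  case (Suc n)
  let ?P = "\<lambda>r. (1 - x * Q ^ r) * (1 - y * Q ^ r)"
  let ?c = "\<lambda>r. (-1) ^ r * Q ^ (Suc r choose 2) * (1 - Q ^ (2 * r + 1))"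
  let ?d = "\<lambda>r. (-1) ^ r * Q ^ (r choose 2) * (1 - Q ^ (2 * r + 1))"
  \<comment> \<open>With \<open>N = Suc n\<close>, it rests on \<open>?P N = Q ^ (N - r) * ?P r + (1 - Q ^ (N - r)) * (1 - Q ^ (N + r + 1))\<close>;
    the first summand contributes a multiple of the unit Bailey pair.\<close>
  have key: "?P (Suc n) * (?c r * p r * i (Suc n - r) * i (Suc n + r + 1)) =
     Q ^ Suc n * (?d r * i (Suc n - r) * i (Suc n + r + 1)) +
     ?c r * p r * ((1 - Q ^ (Suc n - r)) * i (Suc n - r)) * ((1 - Q ^ (Suc n + r + 1)) * i (Suc n + r + 1))"
    if "r \<le> Suc n" for r
  proof -
    define a b where "a = Q ^ r" and "b = Q ^ (Suc n - r)"
    have c: "Q ^ (Suc r choose 2) = a * Q ^ (r choose 2)"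
      by (simp add: numeral_2_eq_2 power_add a_def)
    have q: "Q ^ Suc n = b * a" "Q ^ (Suc n + r + 1) = x * y * (b * a) * a"
      using that by (simp_all only: a_def b_def xy power_add[symmetric] power_Suc[symmetric] mult.assoc) simp_all
    have "(1 - x * (b * a)) * (1 - y * (b * a)) * p r =
        b * ((1 - x * a) * (1 - y * a) * p r) + p r * (1 - b) * (1 - x * y * (b * a) * a)"
      by (simp add: algebra_simps)
    then have *: "(1 - x * (b * a)) * (1 - y * (b * a)) * p r = b + p r * (1 - b) * (1 - x * y * (b * a) * a)"
      using p[of r] by (simp add: a_def)
    have "?P (Suc n) * (?c r * p r * i (Suc n - r) * i (Suc n + r + 1)) =
       (-1) ^ r * (a * Q ^ (r choose 2)) * (1 - Q ^ (2 * r + 1)) * i (Suc n - r) * i (Suc n + r + 1) *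
        ((1 - x * (b * a)) * (1 - y * (b * a)) * p r)"
      unfolding c q(1) by (simp only: ac_simps)
    also have "\<dots> = Q ^ Suc n * (?d r * i (Suc n - r) * i (Suc n + r + 1)) +
     ?c r * p r * ((1 - b) * i (Suc n - r)) * ((1 - x * y * (b * a) * a) * i (Suc n + r + 1))"
      unfolding c q(1) * distrib_left by (simp only: ac_simps)
    finally show ?thesis
      unfolding q(2) b_def .
  qed
  let ?\<alpha> = "\<lambda>r. ?c r * p r"
  have "?P (Suc n) * bailey ?\<alpha> (Suc n) = Q ^ Suc n * bailey ?d (Suc n) +
     (\<Sum>r\<le>Suc n. ?\<alpha> r * ((1 - Q ^ (Suc n - r)) * i (Suc n - r)) * ((1 - Q ^ (Suc n + r + 1)) * i (Suc n + r + 1)))"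
    unfolding bailey_def sum_distrib_left sum.distrib[symmetric]
    by (rule sum.cong[OF refl]) (use key in blast)
  also have "bailey ?d (Suc n) = 0"
    by (subst bailey_unit) simp
  also have "(\<Sum>r\<le>Suc n. ?\<alpha> r * ((1 - Q ^ (Suc n - r)) * i (Suc n - r)) * ((1 - Q ^ (Suc n + r + 1)) * i (Suc n + r + 1)))
      = bailey ?\<alpha> n"
  proof -
    have "(1 - Q ^ (Suc n - r)) * i (Suc n - r) = i (n - r)" if "r \<le> n" for r
      unfolding Suc_diff_le[OF that] by (rule i_step)
    moreover have "(1 - Q ^ (Suc n + r + 1)) * i (Suc n + r + 1) = i (n + r + 1)" for r
      using i_step[of "n + r + 1"] by simp
    ultimately show ?thesis
      unfolding bailey_def by (subst sum.atMost_Suc) (auto intro!: sum.cong)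
  qed
  finally have "?P (Suc n) * bailey ?\<alpha> (Suc n) = (\<Prod>k\<le>n. p k)"
    using Suc.IH by simp
  then have "p (Suc n) * ?P (Suc n) * bailey ?\<alpha> (Suc n) = (\<Prod>k\<le>Suc n. p k)"
    by (simp only: mult.assoc prod.atMost_Suc) (simp only: ac_simps)
  then show ?case
    using p[of "Suc n"] by (simp only: mult.commute[of "p (Suc n)"] mult_1)
qed

section \<open>Bailey's lemma in the limit, as a congruence modulo Q^K\<close>

lemma i_stable:
  assumes "K \<le> n"
  shows "Q ^ Suc K dvd i n - i K"
  using assms
proof (induction n rule: dec_induct)
  case (step n)
  have "i (Suc n) - i K = (i n - i K) + Q ^ Suc n * i (Suc n)"
    using i_step[of n] by (simp add: algebra_simps)
  moreover have "Q ^ Suc K dvd Q ^ Suc n"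
    using step by (intro le_imp_power_dvd) simp
  ultimately show ?case
    using step.IH by (metis dvd_add dvd_mult2)
qed simp

text \<open>In the finite identity the summands of index at least K are multiples of Q^K, and modulo
  Q^K every \<open>i n\<close> with n \<ge> K may be replaced by \<open>i K\<close>. Both sides then
  carry a common factor \<open>i K\<close>, a unit.\<close>

lemma bailey_limit:
  "Q ^ K dvd (\<Sum>n<K. Q ^ (n\<^sup>2 + n) * bailey \<alpha> n) - i K * (\<Sum>r<K. Q ^ (r\<^sup>2 + r) * \<alpha> r)"
proof -
  \<comment> \<open>Large enough that 2K - n and 2K + n + 1 are both at least K for every n <
    K.\<close>
  let ?A = "2 * K"
  have small: "Q ^ K dvd Q ^ (n\<^sup>2 + n) * c" if "K \<le> n" for n c
    using that by (intro dvd_mult2 le_imp_power_dvd) simp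
  have cut: "Q ^ K dvd (\<Sum>n\<le>?A. Q ^ (n\<^sup>2 + n) * f n) - (\<Sum>n<K. Q ^ (n\<^sup>2 + n) * f n)" for f
  proof -
    have "(\<Sum>n\<le>?A. Q ^ (n\<^sup>2 + n) * f n) - (\<Sum>n<K. Q ^ (n\<^sup>2 + n) * f n) =
        (\<Sum>n\<in>{..?A} - {..<K}. Q ^ (n\<^sup>2 + n) * f n)"
      by (subst sum_diff) auto
    then show ?thesis
      by (auto intro!: dvd_sum small)
  qed
  have *: "Q ^ K dvd i n - i K" if "K \<le> n" for n
    using i_stable[OF that] by (meson dvd_trans le_imp_power_dvd le_SucI order_refl)
  have L: "Q ^ K dvd (\<Sum>n<K. Q ^ (n\<^sup>2 + n) * (bailey \<alpha> n * i (?A - n))) -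
      (\<Sum>n<K. Q ^ (n\<^sup>2 + n) * bailey \<alpha> n) * i K"
    unfolding sum_distrib_right sum_subtractf[symmetric]
  proof (rule dvd_sum)
    fix n assume "n \<in> {..<K}"
    then show "Q ^ K dvd Q ^ (n\<^sup>2 + n) * (bailey \<alpha> n * i (?A - n)) - Q ^ (n\<^sup>2 + n) * bailey \<alpha> n * i K"
      using dvd_mult[OF *[of "?A - n"], of "Q ^ (n\<^sup>2 + n) * bailey \<alpha> n"]
      by (simp add: algebra_simps)
  qed
  have R: "Q ^ K dvd (\<Sum>n<K. Q ^ (n\<^sup>2 + n) * (\<alpha> n * i (?A - n) * i (?A + n + 1))) -
      i K * (\<Sum>n<K. Q ^ (n\<^sup>2 + n) * \<alpha> n) * i K"
    unfolding sum_distrib_right sum_distrib_left sum_subtractf[symmetric]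
  proof (rule dvd_sum)
    fix n assume "n \<in> {..<K}"
    then have "Q ^ K dvd (i (?A - n) - i K) * i (?A + n + 1) + i K * (i (?A + n + 1) - i K)"
      by (intro dvd_add dvd_mult dvd_mult2 *) auto
    from dvd_mult[OF this, of "Q ^ (n\<^sup>2 + n) * \<alpha> n"]
    show "Q ^ K dvd Q ^ (n\<^sup>2 + n) * (\<alpha> n * i (?A - n) * i (?A + n + 1)) - i K * (Q ^ (n\<^sup>2 + n) * \<alpha> n) * i K"
      by (simp add: algebra_simps)
  qed
  let ?L = "\<Sum>n<K. Q ^ (n\<^sup>2 + n) * bailey \<alpha> n" and ?R = "i K * (\<Sum>r<K. Q ^ (r\<^sup>2 + r) * \<alpha> r)"
  have "Q ^ K dvd ?R * i K - ?L * i K"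
  proof -
    have "(\<Sum>n\<le>?A. Q ^ (n\<^sup>2 + n) * (bailey \<alpha> n * i (?A - n))) =
       (\<Sum>r\<le>?A. Q ^ (r\<^sup>2 + r) * (\<alpha> r * i (?A - r) * i (?A + r + 1)))"
      using bailey_lemma[of \<alpha> ?A] by (simp only: mult.assoc)
    note eq = this
    have "x dvd r - l" if "x dvd b - l1" "x dvd b - r1" "x dvd l1 - l" "x dvd r1 - r" for x b l1 r1 l r :: 'a
    proof -
      have "r - l = (b - l1) - (b - r1) + (l1 - l) - (r1 - r)" by simp
      then show ?thesis using that by (simp only: dvd_add dvd_diff)
    qed
    from this[OF cut cut[of "\<lambda>n. \<alpha> n * i (?A - n) * i (?A + n + 1)", folded eq] L R] show ?thesis .
  qed
  \<comment> \<open>This product is the inverse of \<open>i K\<close>; the minus sign exchanges the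
    two sides.\<close>
  from dvd_mult[OF this, of "- (\<Prod>k<K. 1 - Q ^ Suc k)"]
  have "Q ^ K dvd (\<Prod>k<K. 1 - Q ^ Suc k) * i K * (?L - ?R)"
    by (simp add: algebra_simps)
  then show ?thesis
    unfolding i_unit by simp
qed

end

section \<open>Representations by the form $x^2 + 3 z^2$\<close>

definition chi3 :: "nat \<Rightarrow> int" where
  "chi3 d = (if d mod 3 = 1 then 1 else if d mod 3 = 2 then -1 else 0)"

lemma chi3_mult: "chi3 (a * b) = chi3 a * chi3 b"
proof -
  have *: "(a * b) mod 3 = ((a mod 3) * (b mod 3)) mod 3" by (rule mod_mult_eq[symmetric])
  have "a mod 3 = 0 \<or> a mod 3 = 1 \<or> a mod 3 = 2" "b mod 3 = 0 \<or> b mod 3 = 1 \<or> b mod 3 = 2"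
    by linarith+
  then show ?thesis
    unfolding chi3_def * by (elim disjE) simp_all
qed

definition chi3_sum :: "nat \<Rightarrow> int" where
  "chi3_sum m = (\<Sum>d | d dvd m. chi3 d)"

text \<open>A divisor of \<open>p * m\<close> divides m or is p times a divisor of m, and the
  overlap is p times the divisors of \<open>m div p\<close>. Inclusion-exclusion gives the recursion
  that the representation numbers will be shown to satisfy as well.\<close>

lemma chi3_sum_prime_mult:
  assumes p: "prime p" and m: "m > 0"
  shows "chi3_sum (p * m) = chi3_sum m + chi3 p * chi3_sum m
    - chi3 p * (if p dvd m then chi3_sum (m div p) else 0)"
proof -
  let ?D = "\<lambda>m. {d::nat. d dvd m}"
  have p0: "p > 0" using p prime_gt_0_nat by blast
  have fin: "finite (?D m)" using m by simp
  have un: "?D (p * m) = ?D m \<union> (*) p ` ?D m"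
  proof (intro equalityI subsetI)
    fix d assume d: "d \<in> ?D (p * m)"
    show "d \<in> ?D m \<union> (*) p ` ?D m"
    proof (cases "p dvd d")
      case True
      then obtain e where "d = p * e" by (elim dvdE)
      then show ?thesis using d p0 by auto
    next
      case False
      then have "coprime d p" using p by (metis coprime_commute prime_imp_coprime)
      then show ?thesis using d by (simp add: coprime_dvd_mult_right_iff)
    qed
  qed (auto intro: dvd_mult)
  have int: "?D m \<inter> (*) p ` ?D m = (if p dvd m then (*) p ` ?D (m div p) else {})"
  proof (cases "p dvd m")
    case True
    then obtain k where "m = p * k" by (elim dvdE)
    then show ?thesis using p0 by (auto intro: dvd_mult)
  qed (auto dest: dvd_mult_left)
  have im: "(\<Sum>d\<in>(*) p ` ?D k. chi3 d) = chi3 p * chi3_sum k" for k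
    using p0 by (subst sum.reindex) (auto simp: inj_on_def chi3_sum_def chi3_mult sum_distrib_left)
  have "chi3_sum (p * m) = (\<Sum>d\<in>?D m. chi3 d) + (\<Sum>d\<in>(*) p ` ?D m. chi3 d)
      - (\<Sum>d\<in>?D m \<inter> (*) p ` ?D m. chi3 d)"
    unfolding chi3_sum_def un using fin by (subst sum_Un) auto
  then show ?thesis
    unfolding int im by (auto simp: im chi3_sum_def)
qed

section \<open>Primes of the form a^2 + 3b^2\<close>

lemma Legendre_minus_3:
  assumes p: "prime p" "p > 3"
  shows "Legendre (-3) (int p) = Legendre (int p) 3"
proof -
  define h where "h = (p - 1) div 2"
  have p2: "2 < p" using p by simp
  have "Legendre (int p) 3 * Legendre 3 (int p) = (-1) ^ h"
    using Quadratic_Reciprocity[OF p(1) p2, of 3] p by (simp add: h_def)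
  moreover have "Legendre 3 (int p) \<in> {-1, 0, 1}" by (simp add: Legendre_def)
  moreover have "((-1::int) ^ h) \<in> {-1, 1}" by (cases "even h") auto
  ultimately have L3: "Legendre (int p) 3 = (-1) ^ h * Legendre 3 (int p)"
    by (elim insertE emptyE) auto
  \<comment> \<open>Euler's criterion for -3 produces the same sign (-1)^h as reciprocity between p
    and 3.\<close>
  have e: "[Legendre a (int p) = a ^ h] (mod int p)" for a
    unfolding h_def by (rule euler_criterion[OF p(1) p2])
  have "[Legendre (-3) (int p) = (-1) ^ h * 3 ^ h] (mod int p)"
    using e[of "-3"] by (simp flip: power_mult_distrib)
  moreover have "[(-1) ^ h * 3 ^ h = (-1) ^ h * Legendre 3 (int p)] (mod int p)"
    by (rule cong_scalar_left) (rule cong_sym[OF e])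
  ultimately have "[Legendre (-3) (int p) = Legendre (int p) 3] (mod int p)"
    unfolding L3 by (rule cong_trans)
  then have "int p dvd Legendre (-3) (int p) - Legendre (int p) 3"
    by (simp add: cong_iff_dvd_diff)
  \<comment> \<open>Two Legendre symbols differ by at most 2, so for p > 3 their congruence modulo p
    is an equality.\<close>
  moreover have "\<bar>Legendre (-3) (int p) - Legendre (int p) 3\<bar> \<le> 2"
    by (auto simp: Legendre_def)
  ultimately show ?thesis
    using zdvd_not_zless[of "\<bar>Legendre (-3) (int p) - Legendre (int p) 3\<bar>" "int p"] p2 by auto
qed

lemma Legendre_mod_3:
  shows "p mod 3 = 1 \<Longrightarrow> Legendre (int p) 3 = 1" "p mod 3 = 2 \<Longrightarrow> Legendre (int p) 3 = -1"
proof -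
  have m: "int p mod 3 = int (p mod 3)" by (simp add: zmod_int)
  {
    assume p: "p mod 3 = 1"
    have "[1\<^sup>2 = int p] (mod 3)" "\<not> [int p = 0] (mod 3)"
      unfolding cong_def m p by simp_all
    moreover from this(1) have "QuadRes 3 (int p)" unfolding QuadRes_def by (rule exI)
    ultimately show "Legendre (int p) 3 = 1" by (simp only: Legendre_def if_True if_False)
  next
    assume p: "p mod 3 = 2"
    have "\<not> [y\<^sup>2 = int p] (mod 3)" for y
    proof -
      have *: "y\<^sup>2 mod 3 = (y mod 3)\<^sup>2 mod 3" by (rule power_mod[symmetric])
      have "y mod 3 = 0 \<or> y mod 3 = 1 \<or> y mod 3 = 2" by presburger
      then have "(y mod 3)\<^sup>2 mod 3 \<noteq> 2" by (elim disjE) (simp_all only:, simp_all)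
      then show ?thesis unfolding cong_def m p * by simp
    qed
    moreover have "\<not> [int p = 0] (mod 3)"
      unfolding cong_def m p by simp
    ultimately show "Legendre (int p) 3 = -1" by (simp only: Legendre_def QuadRes_def if_False not_ex simp_thms)
  }
qed

text \<open>Pigeonhole: with s the integer part of the square root of p, the box of (s+1)^2 > p
  pairs has two members with the same x - r y modulo p, and their difference is the required
  pair.\<close>

lemma thue_lemma:
  fixes r :: int
  assumes "p > 0"
  obtains x y :: int where "(x, y) \<noteq> (0, 0)" "x\<^sup>2 \<le> int p" "y\<^sup>2 \<le> int p" "int p dvd x - r * y"
proof -
  define s where "s = floor_sqrt p"
  let ?B = "{0..int s} \<times> {0..int s}"
  let ?f = "\<lambda>(x, y). (x - r * y) mod int p"
  have "?f ` ?B \<subseteq> {0..<int p}" using assms by auto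
  then have "card (?f ` ?B) \<le> card {0..<int p}" by (rule card_mono[rotated]) simp
  also have "\<dots> < (Suc s)\<^sup>2"
    using Suc_floor_sqrt_power2_gt[of p] by (simp add: s_def)
  also have "(Suc s)\<^sup>2 = card ?B"
    by (simp add: card_cartesian_product power2_eq_square nat_add_distrib)
  finally have "\<not> inj_on ?f ?B" by (rule pigeonhole)
  then obtain u v where uv: "u \<in> ?B" "v \<in> ?B" "?f u = ?f v" "u \<noteq> v"
    unfolding inj_on_def by blast
  obtain x y x' y' where xy: "u = (x, y)" "v = (x', y')" by (cases u, cases v) blast
  have B: "(x, y) \<in> ?B" "(x', y') \<in> ?B" "(x, y) \<noteq> (x', y')"
      and f: "(x - r * y) mod int p = (x' - r * y') mod int p"
    using uv unfolding xy by simp_all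
  have sq: "(u - v)\<^sup>2 \<le> int p" if "u \<in> {0..int s}" "v \<in> {0..int s}" for u v
  proof -
    have "\<bar>u - v\<bar> \<le> int s" using that by auto
    then have "(u - v)\<^sup>2 \<le> (int s)\<^sup>2" by (subst abs_le_square_iff[symmetric]) simp
    also have "\<dots> \<le> int p" using floor_sqrt_power2_le[of p] by (simp add: s_def flip: of_nat_power)
    finally show ?thesis .
  qed
  show ?thesis
  proof
    show "(x - x', y - y') \<noteq> (0, 0)" using B by auto
    show "(x - x')\<^sup>2 \<le> int p" "(y - y')\<^sup>2 \<le> int p" using B by (auto intro!: sq)
    show "int p dvd (x - x') - r * (y - y')"
      using f by (simp add: mod_eq_dvd_iff algebra_simps)
  qed
qed

text \<open>For r^2 = -3 mod p, Thue's lemma gives x^2 + 3y^2 = kp with 0 < k < 4. The value k = 2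
  would make the left side divisible by 4 and p even; for k = 3 the number x is divisible by 3, and
  division by 3 leads back to k = 1.\<close>

lemma prime_form_exists:
  assumes p: "prime p" "p mod 3 = 1"
  obtains a b :: int where "int p = a\<^sup>2 + 3 * b\<^sup>2"
proof -
  have "p \<noteq> 2" "p \<noteq> 3" using p(2) by auto
  then have p3: "p > 3" using prime_ge_2_nat[OF p(1)] by linarith
  have ip: "prime (int p)" using p by simp
  have "Legendre (-3) (int p) = 1"
    using Legendre_minus_3[OF p(1) p3] Legendre_mod_3(1)[OF p(2)] by simp
  then obtain r where r: "[r\<^sup>2 = -3] (mod int p)"
    unfolding Legendre_def QuadRes_def by (auto split: if_splits)
  obtain x y where xy: "(x, y) \<noteq> (0, 0)" "x\<^sup>2 \<le> int p" "y\<^sup>2 \<le> int p" "int p dvd x - r * y"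
    using thue_lemma[of p r] prime_gt_0_nat[OF p(1)] by blast
  \<comment> \<open>A prime is not a square, so Thue's bounds are strict and k = 4 is
    excluded.\<close>
  have nsq: "u\<^sup>2 \<noteq> int p" for u
  proof
    assume "u\<^sup>2 = int p"
    then have "prime (u\<^sup>2)" using ip by simp
    then show False unfolding prime_power_iff by simp
  qed
  have lt: "x\<^sup>2 < int p" "y\<^sup>2 < int p" using xy(2,3) nsq[of x] nsq[of y] by linarith+
  have "int p dvd (x - r * y) * (x + r * y) + (r\<^sup>2 + 3) * y\<^sup>2"
    using xy(4) r by (intro dvd_add[OF dvd_mult2 dvd_mult2]) (simp_all add: cong_iff_dvd_diff)
  also have "(x - r * y) * (x + r * y) + (r\<^sup>2 + 3) * y\<^sup>2 = x\<^sup>2 + 3 * y\<^sup>2"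
    by (simp add: power2_eq_square algebra_simps)
  finally obtain k where k: "x\<^sup>2 + 3 * y\<^sup>2 = int p * k" by (elim dvdE)
  have "int p * k > 0"
    unfolding k[symmetric] using xy(1) by (cases "x = 0") (simp_all add: add_pos_nonneg)
  moreover have "int p * k < int p * 4" using lt k by linarith
  ultimately have "k > 0" "k < 4" using p3 by (simp_all add: zero_less_mult_iff)
  then consider "k = 1" | "k = 2" | "k = 3" by linarith
  then show ?thesis
  proof cases
    case 1
    then show ?thesis using that[of x y] k by simp
  next
    case 2
    have "even (x\<^sup>2 + 3 * y\<^sup>2)" using k 2 by simp
    then have "even x = even y" by simp
    then have "4 dvd x\<^sup>2 + 3 * y\<^sup>2"
    proof (cases "even x")
      case True
      then have "even y" using \<open>even x = even y\<close> by simp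
      with True show ?thesis by (auto elim!: evenE simp: power_mult_distrib)
    next
      case False
      then have "odd y" using \<open>even x = even y\<close> by simp
      with False obtain u v where "x = 2 * u + 1" "y = 2 * v + 1" by (auto elim!: oddE)
      then have "x\<^sup>2 + 3 * y\<^sup>2 = 4 * (u\<^sup>2 + u + 3 * v\<^sup>2 + 3 * v + 1)" by (simp add: power2_eq_square algebra_simps)
      then show ?thesis by simp
    qed
    then have "2 * 2 dvd 2 * int p" unfolding k 2 by (simp add: mult.commute)
    then have "int 2 dvd int p" by (subst (asm) dvd_mult_cancel_left) simp
    then have "2 dvd p" by (simp only: int_dvd_int_iff)
    then have "2 = p" using p(1) by (simp add: primes_dvd_imp_eq)
    then show ?thesis using p3 by simp
  next
    case 3
    have "x\<^sup>2 = 3 * (int p - y\<^sup>2)" using k 3 by simp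
    then have "3 dvd x\<^sup>2" by (rule dvdI)
    then have "3 dvd x" using prime_dvd_power[of "3::int" x 2] by simp
    then obtain u where "x = 3 * u" by (elim dvdE)
    then have "int p = y\<^sup>2 + 3 * u\<^sup>2" using k 3 by (simp add: power_mult_distrib)
    then show ?thesis by (rule that)
  qed
qed

section \<open>Elements of norm m in Z[sqrt(-3)]\<close>

definition norm_reps :: "nat \<Rightarrow> (int \<times> int) set" where
  "norm_reps m = {(x, z). x\<^sup>2 + 3 * z\<^sup>2 = int m}"

lemma finite_norm_reps: "finite (norm_reps m)"
proof (rule finite_subset)
  have le: "\<bar>u\<bar> \<le> u\<^sup>2" for u :: int
    using mult_right_mono[of 1 "\<bar>u\<bar>" "\<bar>u\<bar>"] by (cases "u = 0") (auto simp: power2_eq_square abs_mult_self_eq)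
  have "\<bar>x\<bar> \<le> int m \<and> \<bar>z\<bar> \<le> int m" if "x\<^sup>2 + 3 * z\<^sup>2 = int m" for x z
    using le[of x] le[of z] that zero_le_power2[of x] zero_le_power2[of z] by linarith
  then show "norm_reps m \<subseteq> {-int m..int m} \<times> {-int m..int m}"
    unfolding norm_reps_def by force
qed simp

text \<open>Removing p from both coordinates divides the norm by p^2. This set is the overlap of the
  two images in \<open>card_norm_reps_split\<close> and all of \<open>norm_reps (p * m)\<close> in
  \<open>card_norm_reps_inert\<close>, whence the term at \<open>m div p\<close> in both.\<close>

lemma norm_reps_common_divisor:
  assumes p: "p > 0"
  shows "{(X, Z) \<in> norm_reps (p * m). int p dvd X \<and> int p dvd Z} =
    (if p dvd m then (\<lambda>(x, z). (int p * x, int p * z)) ` norm_reps (m div p) else {})" (is "?L = ?R")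
proof (intro equalityI subsetI)
  let ?p = "int p"
  have sc: "(?p * x)\<^sup>2 + 3 * (?p * z)\<^sup>2 = ?p * (?p * (x\<^sup>2 + 3 * z\<^sup>2))" for x z
    by (simp add: power2_eq_square algebra_simps)
  {
    fix w assume "w \<in> ?L"
    then obtain X Z where w: "w = (X, Z)" "X\<^sup>2 + 3 * Z\<^sup>2 = ?p * int m" "?p dvd X" "?p dvd Z"
      unfolding norm_reps_def by auto
    obtain x z where xz: "X = ?p * x" "Z = ?p * z"
      using w(3,4) unfolding dvd_def by blast
    have "?p * (?p * (x\<^sup>2 + 3 * z\<^sup>2)) = ?p * int m"
      using w(2) unfolding xz sc .
    then have mm: "int m = int p * (x\<^sup>2 + 3 * z\<^sup>2)"
      using p by simp
    then have "int p dvd int m" by (rule dvdI)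
    then have "p dvd m" by simp
    moreover have "int (m div p) = x\<^sup>2 + 3 * z\<^sup>2"
      unfolding zdiv_int mm using p by simp
    then have "(x, z) \<in> norm_reps (m div p)"
      unfolding norm_reps_def by simp
    ultimately show "w \<in> ?R" unfolding w xz by auto
  next
    fix w assume w: "w \<in> ?R"
    then have "p dvd m" by (simp split: if_splits)
    then obtain k where k: "m = p * k" by (elim dvdE)
    then have "w \<in> (\<lambda>(x, z). (?p * x, ?p * z)) ` norm_reps k"
      using w p by simp
    then obtain x z where xz: "w = (?p * x, ?p * z)" "x\<^sup>2 + 3 * z\<^sup>2 = int k"
      unfolding norm_reps_def by auto
    have "(?p * x)\<^sup>2 + 3 * (?p * z)\<^sup>2 = int (p * m)"
      unfolding sc xz(2) k by simp
    then show "w \<in> ?L" unfolding norm_reps_def xz(1) by simp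
  }
qed

lemma card_norm_reps_scale:
  assumes "p > 0"
  shows "card ((\<lambda>(x, z). (int p * x, int p * z)) ` S) = card S"
  using assms by (intro card_image inj_onI) auto

text \<open>Multiplication by a + b sqrt(-3) and by its conjugate embeds the elements of norm m into
  those of norm pm. The images cover the latter and meet exactly in the multiples of p. Describing
  the images by a divisibility condition avoids unique factorization, which fails in
  Z[sqrt(-3)].\<close>

lemma card_norm_reps_split:
  assumes p: "prime p" "p > 3" "int p = a\<^sup>2 + 3 * b\<^sup>2" and m: "m > 0"
  shows "card (norm_reps (p * m)) + (if p dvd m then card (norm_reps (m div p)) else 0) = 2 * card (norm_reps m)"
proof -
  let ?p = "int p"
  have ip: "prime ?p" using p(1) by simp
  have dvd2: "?p dvd u * v \<longleftrightarrow> ?p dvd u \<or> ?p dvd v" for u v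
    using ip by (rule prime_dvd_mult_iff)
  have n3: "\<not> ?p dvd 3" "\<not> ?p dvd 2" using p(2) zdvd_imp_le[of ?p] by fastforce+
  have nsq: "\<not> (?p dvd a \<and> ?p dvd b)"
  proof
    assume "?p dvd a \<and> ?p dvd b"
    then have "?p\<^sup>2 dvd a\<^sup>2 + 3 * b\<^sup>2" by (intro dvd_add dvd_mult) auto
    then have "?p * ?p dvd ?p * 1" unfolding p(3)[symmetric] by (simp add: power2_eq_square)
    then have "?p dvd 1" using p(2) by (subst (asm) dvd_mult_cancel_left) simp
    then show False using p(2) by simp
  qed
  have pa: "\<not> ?p dvd a"
  proof
    assume "?p dvd a"
    then have "?p dvd ?p - a * a" by simp
    also have "?p - a * a = 3 * (b * b)" using p(3) by (simp add: power2_eq_square)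
    finally show False using \<open>?p dvd a\<close> nsq n3 by (auto simp: dvd2)
  qed
  have pb: "\<not> ?p dvd b"
  proof
    assume "?p dvd b"
    then have "?p dvd ?p - 3 * (b * b)" by simp
    also have "?p - 3 * (b * b) = a * a" using p(3) by (simp add: power2_eq_square)
    finally show False using \<open>?p dvd b\<close> nsq by (auto simp: dvd2)
  qed
  \<comment> \<open>\<open>f c\<close> is multiplication by a + c sqrt(-3); it is used for c = b and
    c = -b.\<close>
  define f where "f = (\<lambda>b (x, z). (a * x - 3 * b * z, b * x + a * z))"
  have norm: "(a * x - 3 * c * z)\<^sup>2 + 3 * (c * x + a * z)\<^sup>2 = (a\<^sup>2 + 3 * c\<^sup>2) * (x\<^sup>2 + 3 * z\<^sup>2)" for c x z :: int
    by (simp add: power2_eq_square algebra_simps)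
  have inv: "a * (a * x - 3 * c * z) + 3 * c * (c * x + a * z) = (a\<^sup>2 + 3 * c\<^sup>2) * x"
            "a * (c * x + a * z) - c * (a * x - 3 * c * z) = (a\<^sup>2 + 3 * c\<^sup>2) * z" for c x z :: int
    by (simp_all add: power2_eq_square algebra_simps)
  have inj: "inj_on (f c) S" if "a\<^sup>2 + 3 * c\<^sup>2 = ?p" for c S
  proof (rule inj_onI, clarsimp simp: f_def)
    fix x z x' z'
    assume e: "a * x - 3 * c * z = a * x' - 3 * c * z'" "c * x + a * z = c * x' + a * z'"
    have "?p * x = ?p * x'" "?p * z = ?p * z'"
      by (rule trans[OF sym[OF inv(1)[of x c z, unfolded e that]] inv(1)[of x' c z', unfolded that]],
          rule trans[OF sym[OF inv(2)[of c x z, unfolded e that]] inv(2)[of c x' z', unfolded that]])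
    then show "x = x' \<and> z = z'" using p(2) by simp
  qed
  \<comment> \<open>Division by a + c sqrt(-3) has the coordinates (aX + 3cZ)/p and (aZ - cX)/p.
    Integrality of the second forces that of the first, since p does not divide c.\<close>
  have img: "f c ` norm_reps k = {(X, Z) \<in> norm_reps (p * k). ?p dvd a * Z - c * X}"
    if c: "a\<^sup>2 + 3 * c\<^sup>2 = ?p" "\<not> ?p dvd c" for c k
  proof (intro equalityI subsetI)
    fix w assume "w \<in> f c ` norm_reps k"
    then obtain x z where "x\<^sup>2 + 3 * z\<^sup>2 = int k" "w = (a * x - 3 * c * z, c * x + a * z)"
      by (auto simp: f_def norm_reps_def)
    then show "w \<in> {(X, Z) \<in> norm_reps (p * k). ?p dvd a * Z - c * X}"
      using norm[of x c z] inv(2)[of c x z] c by (simp add: norm_reps_def)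
  next
    fix w assume "w \<in> {(X, Z) \<in> norm_reps (p * k). ?p dvd a * Z - c * X}"
    then obtain X Z where w: "w = (X, Z)" "X\<^sup>2 + 3 * Z\<^sup>2 = ?p * int k" "?p dvd a * Z - c * X"
      by (auto simp: norm_reps_def)
    from w(3) obtain z where z: "a * Z - c * X = ?p * z" by (elim dvdE)
    have "c * (a * X + 3 * c * Z) = ?p * Z - a * (a * Z - c * X)"
      unfolding c(1)[symmetric] by (simp add: power2_eq_square algebra_simps)
    then have "?p dvd c * (a * X + 3 * c * Z)" using w(3) by simp
    then have "?p dvd a * X + 3 * c * Z" using c(2) by (simp add: dvd2)
    then obtain x where x: "a * X + 3 * c * Z = ?p * x" by (elim dvdE)
    have "?p * (a * x - 3 * c * z) = a * (a * X + 3 * c * Z) - 3 * c * (a * Z - c * X)"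
      unfolding x z by (simp add: algebra_simps)
    also have "\<dots> = ?p * X" unfolding c(1)[symmetric] by (simp add: power2_eq_square algebra_simps)
    finally have X: "a * x - 3 * c * z = X" using p(2) by simp
    have "?p * (c * x + a * z) = c * (a * X + 3 * c * Z) + a * (a * Z - c * X)"
      unfolding x z by (simp add: algebra_simps)
    also have "\<dots> = ?p * Z" unfolding c(1)[symmetric] by (simp add: power2_eq_square algebra_simps)
    finally have Z: "c * x + a * z = Z" using p(2) by simp
    have "?p * (x\<^sup>2 + 3 * z\<^sup>2) = ?p * int k"
      using norm[of x c z, symmetric] unfolding X Z c(1) w(2) .
    then have "(x, z) \<in> norm_reps k" using p(2) by (simp add: norm_reps_def)
    then show "w \<in> f c ` norm_reps k" using w(1) X Z by (force simp: f_def)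
  qed
  have b: "a\<^sup>2 + 3 * b\<^sup>2 = ?p" "\<not> ?p dvd b" and mb: "a\<^sup>2 + 3 * (-b)\<^sup>2 = ?p" "\<not> ?p dvd - b"
    using p(3) pb by simp_all
  have un: "norm_reps (p * m) = f b ` norm_reps m \<union> f (-b) ` norm_reps m"
  proof -
    have "?p dvd a * Z - b * X \<or> ?p dvd a * Z - (-b) * X" if "X\<^sup>2 + 3 * Z\<^sup>2 = ?p * int m" for X Z
    proof -
      \<comment> \<open>The product of the two image conditions is a multiple of p, so the prime p
        divides one of the factors.\<close>
      have "(a * Z - b * X) * (a * Z - (-b) * X) = (a\<^sup>2 + 3 * b\<^sup>2) * Z\<^sup>2 - b\<^sup>2 * (X\<^sup>2 + 3 * Z\<^sup>2)"
        by (simp add: power2_eq_square algebra_simps)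
      also have "\<dots> = ?p * (Z\<^sup>2 - b\<^sup>2 * int m)"
        unfolding that b(1) by (simp add: algebra_simps)
      finally show ?thesis using dvd2 by (metis dvd_triv_left)
    qed
    then show ?thesis unfolding img[OF b] img[OF mb] by (auto simp: norm_reps_def)
  qed
  have int: "f b ` norm_reps m \<inter> f (-b) ` norm_reps m =
      (if p dvd m then (\<lambda>(x, z). (?p * x, ?p * z)) ` norm_reps (m div p) else {})"
  proof -
    have "?p dvd a * Z - b * X \<and> ?p dvd a * Z - (-b) * X \<longleftrightarrow> ?p dvd X \<and> ?p dvd Z" for X Z
    proof
      assume d: "?p dvd a * Z - b * X \<and> ?p dvd a * Z - (-b) * X"
      then have "?p dvd (a * Z - (-b) * X) + (a * Z - b * X)" "?p dvd (a * Z - (-b) * X) - (a * Z - b * X)"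
        by (simp_all only: dvd_add dvd_diff)
      then have "?p dvd 2 * (a * Z)" "?p dvd 2 * (b * X)" by (simp_all add: mult.commute)
      then show "?p dvd X \<and> ?p dvd Z" using n3 pa pb by (simp add: dvd2)
    qed simp
    moreover have "f b ` norm_reps m \<inter> f (-b) ` norm_reps m =
        {(X, Z) \<in> norm_reps (p * m). ?p dvd a * Z - b * X \<and> ?p dvd a * Z - (-b) * X}"
      unfolding img[OF b] img[OF mb] by auto
    ultimately show ?thesis
      using norm_reps_common_divisor[of p m] p(2) by simp
  qed
  have "card (norm_reps (p * m)) + card (f b ` norm_reps m \<inter> f (-b) ` norm_reps m) = card (f b ` norm_reps m) + card (f (-b) ` norm_reps m)"
    unfolding un using card_Un_Int[of "f b ` norm_reps m" "f (-b) ` norm_reps m"] by (simp add: finite_norm_reps)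
  moreover note card_norm_reps_scale[of p]
  ultimately show ?thesis
    unfolding int card_image[OF inj[OF b(1)]] card_image[OF inj[OF mb(1)]] using p(2) by (cases "p dvd m") auto
qed

text \<open>If p did not divide Z, then X/Z would be a square root of -3 modulo p, but -3 is a
  nonresidue. Hence p divides both coordinates.\<close>

lemma card_norm_reps_inert:
  assumes p: "prime p" "p > 3" "p mod 3 = 2" and m: "m > 0"
  shows "card (norm_reps (p * m)) = (if p dvd m then card (norm_reps (m div p)) else 0)"
proof -
  let ?p = "int p"
  have ip: "prime ?p" using p(1) by simp
  have L: "Legendre (-3) ?p = -1"
    using Legendre_minus_3[OF p(1,2)] Legendre_mod_3(2)[OF p(3)] by simp
  have dz: "?p dvd Z" if w: "X\<^sup>2 + 3 * Z\<^sup>2 = ?p * int m" for X Z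
  proof (rule ccontr)
    assume "\<not> ?p dvd Z"
    then have "coprime Z ?p" using ip by (metis coprime_commute prime_imp_coprime)
    then obtain u where u: "[Z * u = 1] (mod ?p)" using cong_solve_coprime_int by blast
    have "[(X * u)\<^sup>2 = (X\<^sup>2 + 3 * Z\<^sup>2) * u\<^sup>2 - 3 * (Z * u)\<^sup>2] (mod ?p)"
      by (simp add: power2_eq_square algebra_simps)
    also have "[(X\<^sup>2 + 3 * Z\<^sup>2) * u\<^sup>2 - 3 * (Z * u)\<^sup>2 = 0 - 3 * 1\<^sup>2] (mod ?p)"
      by (intro cong_diff cong_mult cong_pow cong_refl u) (simp add: w cong_0_iff)
    finally have "QuadRes ?p (-3)" unfolding QuadRes_def by auto
    then show False using L by (auto simp: Legendre_def split: if_splits)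
  qed
  have dx: "?p dvd X" if w: "X\<^sup>2 + 3 * Z\<^sup>2 = ?p * int m" for X Z
  proof -
    have "X * X = ?p * int m - 3 * Z\<^sup>2" using w by (simp add: power2_eq_square)
    moreover have "?p dvd ?p * int m - 3 * Z\<^sup>2" using dz[OF w] by (simp add: power2_eq_square)
    ultimately show ?thesis using ip by (metis prime_dvd_mult_iff)
  qed
  have "norm_reps (p * m) = {(X, Z) \<in> norm_reps (p * m). ?p dvd X \<and> ?p dvd Z}"
    using dx dz by (auto simp: norm_reps_def)
  also have "\<dots> = (if p dvd m then (\<lambda>(x, z). (?p * x, ?p * z)) ` norm_reps (m div p) else {})"
    using p(2) by (intro norm_reps_common_divisor) simp
  finally show ?thesis using card_norm_reps_scale[of p] p(2) by simp
qed

text \<open>Both sides obey the same recursion in each prime factor, and at m = 1 the two units 1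
  and -1 account for the factor 2. Some restriction on m is essential: m = 4 has six
  representations, while its divisor sum is 1.\<close>

lemma card_norm_reps:
  assumes "coprime m 6"
  shows "int (card (norm_reps m)) = 2 * chi3_sum m"
  using assms
proof (induction m rule: less_induct)
  case (less m)
  have m0: "m > 0" using less.prems by (cases m) auto
  show ?case
  proof (cases "m = 1")
    case True
    have "norm_reps 1 = {(1, 0), (-1, 0)}"
    proof -
      have "(x = 1 \<or> x = -1) \<and> z = 0" if "x\<^sup>2 + 3 * z\<^sup>2 = 1" for x z :: int
      proof -
        have "z = 0"
        proof (rule ccontr)
          assume "z \<noteq> 0"
          then have "z\<^sup>2 > 0" by simp
          then show False using that zero_le_power2[of x] by linarith
        qed
        then show ?thesis using that by (simp add: power2_eq_1_iff)
      qed
      then show ?thesis by (auto simp: norm_reps_def)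
    qed
    moreover have "{d::nat. d dvd 1} = {1}" by auto
    ultimately show ?thesis using True by (simp add: chi3_sum_def chi3_def)
  next
    case False
    then obtain p where p: "prime p" "p dvd m" using prime_factor_nat by blast
    then obtain k where k: "m = p * k" by (elim dvdE)
    have cop: "coprime p 6" "coprime k 6" using less.prems k by simp_all
    have "p > 1" using p prime_gt_1_nat by blast
    then have km: "k < m" "k > 0" using k m0 by auto
    have p3: "p > 3" and pm: "p mod 3 = 1 \<or> p mod 3 = 2"
    proof -
      have "\<not> 2 dvd p" "\<not> 3 dvd p"
        using coprime_common_divisor[OF cop(1), of 2] coprime_common_divisor[OF cop(1), of 3] by auto
      then show "p > 3" "p mod 3 = 1 \<or> p mod 3 = 2" using \<open>p > 1\<close> by presburger+
    qed
    have div: "int (card (norm_reps (k div p))) = 2 * chi3_sum (k div p)" if "p dvd k"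
    proof (rule less.IH)
      show "k div p < m" using km \<open>p > 1\<close> by (meson div_le_dividend le_less_trans)
      show "coprime (k div p) 6" using cop(2) that by (metis coprime_mult_left_iff dvd_div_mult_self)
    qed
    have IH: "int (card (norm_reps k)) = 2 * chi3_sum k" using less.IH km cop by blast
    from pm show ?thesis
    proof
      assume p1: "p mod 3 = 1"
      then obtain a b where ab: "int p = a\<^sup>2 + 3 * b\<^sup>2" using prime_form_exists p by blast
      have "chi3 p = 1" using p1 by (simp add: chi3_def)
      then show ?thesis
        using card_norm_reps_split[OF p(1) p3 ab km(2)] chi3_sum_prime_mult[OF p(1) km(2)] IH div
        unfolding k by (auto split: if_splits)
    next
      assume p1: "p mod 3 = 2"
      have "chi3 p = -1" using p1 by (simp add: chi3_def)
      then show ?thesis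
        using card_norm_reps_inert[OF p(1) p3 p1 km(2)] chi3_sum_prime_mult[OF p(1) km(2)] IH div
        unfolding k by (auto split: if_splits)
    qed
  qed
qed

section \<open>Representations and divisors of m = 1 mod 12\<close>

lemma card_involution:
  assumes "finite S" "\<And>s. s \<in> S \<Longrightarrow> \<sigma> s \<in> S" "\<And>s. s \<in> S \<Longrightarrow> \<sigma> (\<sigma> s) = s"
    and "\<And>s. s \<in> S \<Longrightarrow> pos (\<sigma> s) \<longleftrightarrow> \<not> pos s"
  shows "card S = 2 * card {s \<in> S. pos s}"
proof -
  have "bij_betw \<sigma> {s \<in> S. pos s} {s \<in> S. \<not> pos s}"
    by (rule bij_betw_byWitness[where f' = \<sigma>]) (use assms in auto)
  then have "card {s \<in> S. \<not> pos s} = card {s \<in> S. pos s}"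
    by (simp add: bij_betw_same_card)
  moreover have "card S = card {s \<in> S. pos s} + card {s \<in> S. \<not> pos s}"
    by (subst card_Un_disjoint[symmetric]) (use assms(1) in \<open>auto intro: arg_cong[where f = card]\<close>)
  ultimately show ?thesis by simp
qed

text \<open>Modulo 3 the coordinate x cannot vanish, and modulo 4 the coordinate z must be even, so
  z = 2n turns the form into x^2 + 12n^2. Sign changes group the pairs with z nonzero in fours and
  those with z = 0 in twos.\<close>

lemma card_norm_reps_positive:
  assumes m: "m mod 12 = 1"
  shows "card (norm_reps m) = 4 * card {x::nat. x > 0 \<and> (\<exists>n>0. x\<^sup>2 + 12 * n\<^sup>2 = m)} + 2 * card {d. d dvd m \<and> d\<^sup>2 = m}"
proof -
  let ?X = "{x::nat. x > 0 \<and> (\<exists>n>0. x\<^sup>2 + 12 * n\<^sup>2 = m)}"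
  define P where "P = {(x, z) \<in> norm_reps m. x > 0 \<and> z > 0}"
  define R where "R = {(x, z) \<in> norm_reps m. z \<noteq> 0}"
  define R0 where "R0 = {(x, z) \<in> norm_reps m. z = 0}"
  have R: "norm_reps m = R \<union> R0" "R \<inter> R0 = {}" by (auto simp: R_def R0_def)
  have fin: "finite R" "finite R0" "finite P"
    by (auto intro: finite_subset[OF _ finite_norm_reps] simp: R_def R0_def P_def)
  have x0: "x \<noteq> 0" and even_z: "even z" if "(x, z) \<in> norm_reps m" for x z
  proof -
    have eq: "x\<^sup>2 + 3 * z\<^sup>2 = int m" using that by (simp add: norm_reps_def)
    define k where "k = int (m div 12)"
    have "m = 12 * (m div 12) + 1" using m by presburger
    then have im: "int m = 12 * k + 1" unfolding k_def by linarith
    \<comment> \<open>Residues modulo 3 exclude x = 0; residues modulo 4 exclude x even with z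
      odd.\<close>
    have "3 * A \<noteq> 12 * k + 1" "4 * A + 12 * B + 3 \<noteq> 12 * k + 1" for A B :: int by presburger+
    note ne = this
    show "x \<noteq> 0"
    proof
      assume "x = 0"
      then show False using eq im ne(1)[of "z\<^sup>2"] by simp
    qed
    show "even z"
    proof (rule ccontr)
      assume "odd z"
      then obtain v where "z = 2 * v + 1" by (elim oddE)
      then have z: "z\<^sup>2 = 4 * (v\<^sup>2 + v) + 1" by (simp add: power2_eq_square algebra_simps)
      have "x\<^sup>2 = 2 * (6 * k - 6 * (v\<^sup>2 + v) - 1)" using eq unfolding im z by simp
      then have "even (x\<^sup>2)" by (rule dvdI)
      then have "even x" by simp
      then obtain u where "x = 2 * u" by (elim evenE)
      then have x: "x\<^sup>2 = 4 * u\<^sup>2" by simp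
      show False using eq ne(2)[of "u\<^sup>2" "v\<^sup>2 + v"] unfolding im x z by simp
    qed
  qed
  have "card R = 2 * card {s \<in> R. snd s > 0}"
    by (rule card_involution[where \<sigma> = "\<lambda>(x, z). (x, -z)"]) (use fin in \<open>auto simp: R_def norm_reps_def\<close>)
  also have "card {s \<in> R. snd s > 0} = 2 * card {s \<in> {s \<in> R. snd s > 0}. fst s > 0}"
  proof (rule card_involution[where \<sigma> = "\<lambda>(x, z). (-x, z)"])
    fix s assume s: "s \<in> {s \<in> R. snd s > 0}"
    then have "fst s \<noteq> 0" using x0 by (cases s) (auto simp: R_def)
    then show "fst (case s of (x, z) \<Rightarrow> (-x, z)) > 0 \<longleftrightarrow> \<not> fst s > 0" by (simp add: split_beta) linarith
  qed (use fin in \<open>auto simp: R_def norm_reps_def\<close>)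
  also have "{s \<in> {s \<in> R. snd s > 0}. fst s > 0} = P" by (auto simp: P_def R_def)
  finally have cR: "card R = 4 * card P" by simp
  have "(\<lambda>(x, z). nat x) ` P = ?X"
  proof (intro equalityI subsetI)
    fix w assume "w \<in> (\<lambda>(x, z). nat x) ` P"
    then obtain x z where xz: "w = nat x" "(x, z) \<in> norm_reps m" "x > 0" "z > 0" by (auto simp: P_def)
    obtain v where v: "z = 2 * v" using even_z[OF xz(2)] by (elim evenE)
    have "int (w\<^sup>2 + 12 * (nat v)\<^sup>2) = int m"
      using xz v by (simp add: norm_reps_def)
    then have "w\<^sup>2 + 12 * (nat v)\<^sup>2 = m" by (simp only: of_nat_eq_iff)
    then show "w \<in> ?X" using xz v by auto
  next
    fix x assume "x \<in> ?X"
    then obtain n where n: "x > 0" "n > 0" "x\<^sup>2 + 12 * n\<^sup>2 = m" by blast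
    have "int (x\<^sup>2 + 12 * n\<^sup>2) = int m" using n by simp
    then have "(int x)\<^sup>2 + 3 * (2 * int n)\<^sup>2 = int m" by simp
    then have "(int x, 2 * int n) \<in> P" using n(1,2) by (simp add: P_def norm_reps_def)
    then show "x \<in> (\<lambda>(x, z). nat x) ` P" by force
  qed
  moreover have "inj_on (\<lambda>(x, z). nat x) P"
  proof (rule inj_onI)
    fix s t assume st: "s \<in> P" "t \<in> P" "(case s of (x, z) \<Rightarrow> nat x) = (case t of (x, z) \<Rightarrow> nat x)"
    obtain x z where s: "s = (x, z)" "x\<^sup>2 + 3 * z\<^sup>2 = int m" "x > 0" "z > 0"
      using st(1) unfolding P_def norm_reps_def by auto
    obtain x' z' where t: "t = (x', z')" "x'\<^sup>2 + 3 * z'\<^sup>2 = int m" "x' > 0" "z' > 0"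
      using st(2) unfolding P_def norm_reps_def by auto
    have x: "x = x'" using st(3) s(3) t(3) unfolding s(1) t(1) by simp
    then have "z\<^sup>2 = z'\<^sup>2" using s(2) t(2) by simp
    then have "z = z' \<or> z = - z'" by (simp only: power2_eq_iff)
    then have "z = z'" using s(4) t(4) by linarith
    then show "s = t" using x s(1) t(1) by simp
  qed
  ultimately have cP: "card P = card ?X" using card_image by metis
  have "card R0 = 2 * card {s \<in> R0. fst s > 0}"
  proof (rule card_involution[where \<sigma> = "\<lambda>(x, z). (-x, z)"])
    fix s assume s: "s \<in> R0"
    then have "fst s \<noteq> 0" using x0 by (cases s) (auto simp: R0_def)
    then show "fst (case s of (x, z) \<Rightarrow> (-x, z)) > 0 \<longleftrightarrow> \<not> fst s > 0" by (simp add: split_beta) linarith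
  qed (use fin in \<open>auto simp: R0_def norm_reps_def\<close>)
  also have "{s \<in> R0. fst s > 0} = (\<lambda>d. (int d, 0)) ` {d. d dvd m \<and> d\<^sup>2 = m}"
  proof (intro equalityI subsetI)
    fix s assume "s \<in> {s \<in> R0. fst s > 0}"
    then obtain x where x: "s = (x, 0)" "x\<^sup>2 = int m" "x > 0" by (auto simp: R0_def norm_reps_def)
    then have "(nat x)\<^sup>2 = m" by (simp add: nat_power_eq[symmetric])
    then have "nat x \<in> {d. d dvd m \<and> d\<^sup>2 = m}" by auto
    moreover have "s = (int (nat x), 0)" using x by simp
    ultimately show "s \<in> (\<lambda>d. (int d, 0)) ` {d. d dvd m \<and> d\<^sup>2 = m}" by blast
  next
    fix s :: "int \<times> int" assume "s \<in> (\<lambda>d. (int d, 0)) ` {d. d dvd m \<and> d\<^sup>2 = m}"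
    then obtain d where d: "s = (int d, 0)" "d\<^sup>2 = m" by blast
    have "d \<noteq> 0" using d(2) m by (cases "d = 0") auto
    moreover have "(int d)\<^sup>2 = int m" using d(2) by (simp flip: of_nat_power)
    ultimately show "s \<in> {s \<in> R0. fst s > 0}" using d by (simp add: R0_def norm_reps_def)
  qed
  also have "card \<dots> = card {d. d dvd m \<and> d\<^sup>2 = m}"
    by (rule card_image) (simp add: inj_on_def)
  finally have "card R0 = 2 * card {d. d dvd m \<and> d\<^sup>2 = m}" .
  then show ?thesis
    unfolding R(1) using cR cP by (subst card_Un_disjoint) (use fin R(2) in auto)
qed

text \<open>Since \<open>chi3 m = 1\<close>, the complementary divisors d and m/d have the same
  character value, so each divisor below the square root counts twice.\<close>

lemma chi3_sum_divisor_pairs: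
  assumes m: "m mod 12 = 1"
  shows "chi3_sum m = 2 * (int (card {d. d dvd m \<and> d mod 6 = 1 \<and> d\<^sup>2 < m}) - int (card {d. d dvd m \<and> d mod 6 = 5 \<and> d\<^sup>2 < m}))
     + int (card {d. d dvd m \<and> d mod 6 = 1 \<and> d\<^sup>2 = m}) - int (card {d. d dvd m \<and> d mod 6 = 5 \<and> d\<^sup>2 = m})"
proof -
  have m0: "m > 0" using m by (cases m) auto
  then have fin: "finite {d. d dvd m}" by simp
  have cases: "d mod 6 = 1 \<or> d mod 6 = 5" if "d dvd m" for d
  proof -
    have "\<not> 2 dvd m" "\<not> 3 dvd m" using m by presburger+
    then have "\<not> 2 dvd d" "\<not> 3 dvd d" using dvd_trans[OF _ that] by blast+
    then show ?thesis by presburger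
  qed
  have split: "(\<Sum>d | d dvd m \<and> P d. chi3 d) =
      int (card {d. d dvd m \<and> d mod 6 = 1 \<and> P d}) - int (card {d. d dvd m \<and> d mod 6 = 5 \<and> P d})" for P
  proof -
    have eq: "{d. d dvd m \<and> P d} = {d. d dvd m \<and> d mod 6 = 1 \<and> P d} \<union> {d. d dvd m \<and> d mod 6 = 5 \<and> P d}"
      using cases by auto
    have "chi3 d = 1" if "d mod 6 = 1" for d
    proof -
      have "d mod 3 = 1" using that by presburger
      then show ?thesis by (simp add: chi3_def)
    qed
    moreover have "chi3 d = -1" if "d mod 6 = 5" for d
    proof -
      have "d mod 3 = 2" using that by presburger
      then show ?thesis by (simp add: chi3_def)
    qed
    ultimately show ?thesis
      unfolding eq by (subst sum.union_disjoint) (use fin in auto)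
  qed
  have "(\<Sum>d | d dvd m \<and> m < d\<^sup>2. chi3 d) = (\<Sum>d | d dvd m \<and> d\<^sup>2 < m. chi3 d)"
  proof (rule sum.reindex_bij_witness[of _ "\<lambda>d. m div d" "\<lambda>d. m div d"])
    have less: "(m div d)\<^sup>2 < m \<longleftrightarrow> m < d\<^sup>2" "m < (m div d)\<^sup>2 \<longleftrightarrow> d\<^sup>2 < m" "d > 0" "m div d dvd m" "m div (m div d) = d"
      "chi3 (m div d) = chi3 d" if d: "d dvd m" for d
    proof -
      obtain e where e: "m = d * e" using d unfolding dvd_def by blast
      have pos: "d > 0" "e > 0" using m0 e by auto
      have "m mod 3 = 1" using m by presburger
      then have m3: "chi3 m = 1" by (simp add: chi3_def)
      have "chi3 d * chi3 e = chi3 m" by (simp add: e chi3_mult)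
      also note m3
      finally have "chi3 d * chi3 e = 1" .
      then have "chi3 e = chi3 d" by (simp add: chi3_def split: if_splits)
      moreover have "m div d = e" using e pos by simp
      ultimately show "(m div d)\<^sup>2 < m \<longleftrightarrow> m < d\<^sup>2" "m < (m div d)\<^sup>2 \<longleftrightarrow> d\<^sup>2 < m" "d > 0" "m div d dvd m" "m div (m div d) = d"
        "chi3 (m div d) = chi3 d"
        using e pos by (simp_all add: power2_eq_square)
    qed
    fix d
    {
      assume "d \<in> {d. d dvd m \<and> m < d\<^sup>2}"
      then show "m div (m div d) = d" "m div d \<in> {d. d dvd m \<and> d\<^sup>2 < m}" "chi3 (m div d) = chi3 d"
        using less[of d] by simp_all
    next
      assume "d \<in> {d. d dvd m \<and> d\<^sup>2 < m}"
      then show "m div (m div d) = d" "m div d \<in> {d. d dvd m \<and> m < d\<^sup>2}"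
        using less[of d] by simp_all
    }
  qed
  moreover have "chi3_sum m = (\<Sum>d | d dvd m \<and> d\<^sup>2 < m. chi3 d) + (\<Sum>d | d dvd m \<and> m < d\<^sup>2. chi3 d)
      + (\<Sum>d | d dvd m \<and> d\<^sup>2 = m. chi3 d)"
  proof -
    have "{d. d dvd m} = ({d. d dvd m \<and> d\<^sup>2 < m} \<union> {d. d dvd m \<and> m < d\<^sup>2}) \<union> {d. d dvd m \<and> d\<^sup>2 = m}"
      (is "_ = (?A \<union> ?B) \<union> ?C") by auto
    then have "chi3_sum m = sum chi3 ((?A \<union> ?B) \<union> ?C)"
      unfolding chi3_sum_def by (rule arg_cong[where f = "sum chi3"])
    also have "sum chi3 ((?A \<union> ?B) \<union> ?C) = sum chi3 (?A \<union> ?B) + sum chi3 ?C"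
      by (rule sum.union_disjoint) (use fin in auto)
    also have "sum chi3 (?A \<union> ?B) = sum chi3 ?A + sum chi3 ?B"
      by (rule sum.union_disjoint) (use fin in auto)
    finally show ?thesis .
  qed
  ultimately show ?thesis
    unfolding split by simp
qed

text \<open>Equating the two formulas and dividing by 4 shows that the first cardinality is the
  second minus the third. A square root congruent to 1 modulo 6 cancels; one congruent to 5 joins
  the third set.\<close>

lemma even_representations_plus_divisors:
  assumes m: "m mod 12 = 1"
  shows "even (card {x::nat. x > 0 \<and> (\<exists>n>0. x\<^sup>2 + 12 * n\<^sup>2 = m)}
    + card {d. d dvd m \<and> d mod 6 = 1 \<and> d\<^sup>2 < m} + card {d. d dvd m \<and> d mod 6 = 5 \<and> d\<^sup>2 \<le> m})"
proof -
  have m0: "m > 0" using m by (cases m) auto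
  then have fin: "finite {d. d dvd m}" by simp
  have "\<not> 2 dvd m" "\<not> 3 dvd m" using m by presburger+
  then have "coprime 2 m" "coprime 3 m" by (simp_all add: prime_imp_coprime)
  then have "coprime (2 * 3) m" by (simp only: coprime_mult_left_iff)
  then have cop: "coprime m 6" by (simp add: coprime_commute)
  let ?E = "\<lambda>k. {d. d dvd m \<and> d mod 6 = k \<and> d\<^sup>2 = m}"
  have "d mod 6 = 1 \<or> d mod 6 = 5" if "d dvd m" for d
  proof -
    have "\<not> 2 dvd d" "\<not> 3 dvd d" using that dvd_trans \<open>\<not> 2 dvd m\<close> \<open>\<not> 3 dvd m\<close> by blast+
    then show ?thesis by presburger
  qed
  then have "{d. d dvd m \<and> d\<^sup>2 = m} = ?E 1 \<union> ?E 5" by auto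
  then have E: "card {d. d dvd m \<and> d\<^sup>2 = m} = card (?E 1) + card (?E 5)"
    using fin by (simp add: card_Un_disjoint disjoint_iff)
  have "{d. d dvd m \<and> d mod 6 = 5 \<and> d\<^sup>2 \<le> m} = {d. d dvd m \<and> d mod 6 = 5 \<and> d\<^sup>2 < m} \<union> ?E 5" by auto
  then have B: "card {d. d dvd m \<and> d mod 6 = 5 \<and> d\<^sup>2 \<le> m} = card {d. d dvd m \<and> d mod 6 = 5 \<and> d\<^sup>2 < m} + card (?E 5)"
    using fin by (simp add: card_Un_disjoint disjoint_iff)
  show ?thesis
    using card_norm_reps[OF cop] unfolding card_norm_reps_positive[OF m] chi3_sum_divisor_pairs[OF m] E B by presburger
qed

section \<open>Trisection of the mock theta function\<close>

unbundle fps_syntax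

section \<open>Reciprocals of 1 - q^m and of finite products, and their trisection\<close>

definition geom :: "nat \<Rightarrow> int fps" where
  "geom m = Abs_fps (\<lambda>n. of_bool (m dvd n))"

lemma geom_inverse:
  assumes "m > 0"
  shows "(1 - fps_X ^ m) * geom m = 1"
proof (rule fps_ext)
  fix n
  show "((1 - fps_X ^ m) * geom m) $ n = 1 $ n"
    using assms by (auto simp: geom_def left_diff_distrib fps_X_power_mult_nth dvd_minus_self dest: dvd_imp_le)
qed

lemma geom_inverse_6:
  "(1 - fps_X ^ (6 * k + 1)) * geom (6 * k + 1) = 1"
  "(1 - fps_X ^ (6 * k + 5)) * geom (6 * k + 5) = 1"
  by (rule geom_inverse, simp)+

lemma X_power_geom_nth: "(fps_X ^ a * geom m) $ n = of_bool (\<exists>j. n = a + m * j)"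
  by (auto simp: fps_X_power_mult_nth geom_def dvd_def intro: le_add_diff_inverse[symmetric]) (metis le_add_diff_inverse not_less)

text \<open>The reciprocal of (q^s;q^s)_n, used for s = 6 before the trisection and for s = 2 after
  it.\<close>

definition qinv :: "nat \<Rightarrow> nat \<Rightarrow> int fps" where
  "qinv s n = (\<Prod>k<n. geom (s * Suc k))"

lemma q_inverses_qinv:
  assumes "s > 0"
  shows "q_inverses (fps_X ^ s) (qinv s)"
proof
  fix n
  have "(1 - (fps_X ^ s) ^ Suc n) * geom (s * Suc n) = 1"
    using geom_inverse[of "s * Suc n"] assms by (simp only: power_mult[symmetric]) simp
  then show "(1 - (fps_X ^ s) ^ Suc n) * qinv s (Suc n) = qinv s n"
    by (simp add: qinv_def mult.left_commute del: power_Suc)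
qed (simp add: qinv_def)

definition trisect :: "int fps \<Rightarrow> int fps" where
  "trisect f = Abs_fps (\<lambda>n. f $ (3 * n))"

lemma trisect_nth [simp]: "trisect f $ n = f $ (3 * n)"
  by (simp add: trisect_def)

lemma trisect_diff: "trisect (f - g) = trisect f - trisect g"
  by (rule fps_ext) simp

lemma trisect_add: "trisect (f + g) = trisect f + trisect g"
  by (rule fps_ext) simp

lemma trisect_sum: "trisect (sum f A) = (\<Sum>a\<in>A. trisect (f a))"
  by (rule fps_ext) (simp add: fps_sum_nth)

lemma trisect_uminus_power: "trisect ((-1) ^ r * f) = (-1) ^ r * trisect f"
  by (rule fps_ext) (cases "even r"; simp)

lemma trisect_X_power: "trisect (fps_X ^ (3 * a) * f) = fps_X ^ a * trisect f"
  by (rule fps_ext) (auto simp: fps_X_power_mult_nth right_diff_distrib')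

text \<open>A factor that is a series in q^3 can be pulled out with q^3 replaced by q. In the
  induction this is applied to 1 - q^(6k), which becomes 1 - q^(2k).\<close>

lemma trisect_qinv: "trisect (qinv 6 n * f) = qinv 2 n * trisect f"
proof (induction n arbitrary: f)
  case (Suc n)
  interpret six: q_inverses "fps_X ^ 6" "qinv 6" by (rule q_inverses_qinv) simp
  interpret two: q_inverses "fps_X ^ 2" "qinv 2" by (rule q_inverses_qinv) simp
  have six: "((fps_X::int fps) ^ 6) ^ Suc n = fps_X ^ (3 * (2 * Suc n))"
    by (simp only: power_mult[symmetric]) simp
  have two: "((fps_X::int fps) ^ 2) ^ Suc n = fps_X ^ (2 * Suc n)"
    by (simp only: power_mult[symmetric])
  have "(1 - (fps_X ^ 2) ^ Suc n) * trisect (qinv 6 (Suc n) * f) =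
      trisect ((1 - (fps_X ^ 6) ^ Suc n) * qinv 6 (Suc n) * f)"
    unfolding six two left_diff_distrib trisect_diff mult.assoc trisect_X_power mult_1_left ..
  also have "\<dots> = qinv 2 n * trisect f"
    unfolding six.i_step by (rule Suc.IH)
  also have "\<dots> = (1 - (fps_X ^ 2) ^ Suc n) * (qinv 2 (Suc n) * trisect f)"
    unfolding two.i_step[of n, symmetric] by (simp only: mult.assoc)
  finally show ?case by (rule two.cancel[rotated]) simp
qed (simp add: qinv_def)

text \<open>As 6r + 1 is 1 modulo 3, the exponent 1 + (6r+1)k is a multiple of 3 exactly for k = 3j
  + 2, and the least one is 3(4r+1).\<close>

lemma trisect_geom_1: "trisect (fps_X * geom (6 * r + 1)) = fps_X ^ (4 * r + 1) * geom (6 * r + 1)"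
proof (rule fps_ext)
  fix n
  have "(\<exists>j. 3 * n = 1 + (6 * r + 1) * j) \<longleftrightarrow> (\<exists>j. n = 4 * r + 1 + (6 * r + 1) * j)"
  proof
    assume "\<exists>j. 3 * n = 1 + (6 * r + 1) * j"
    then obtain k where k: "3 * n = 1 + (6 * r + 1) * k" by blast
    then have "3 * n = 1 + k + 6 * (r * k)" by (simp add: algebra_simps)
    then have "k mod 3 = 2" by presburger
    then obtain j where "k = 3 * j + 2" by (metis mult_div_mod_eq)
    then have "n = 4 * r + 1 + (6 * r + 1) * j" using k by (simp add: algebra_simps)
    then show "\<exists>j. n = 4 * r + 1 + (6 * r + 1) * j" ..
  next
    assume "\<exists>j. n = 4 * r + 1 + (6 * r + 1) * j"
    then obtain j where "n = 4 * r + 1 + (6 * r + 1) * j" ..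
    then have "3 * n = 1 + (6 * r + 1) * (3 * j + 2)" by (simp add: algebra_simps)
    then show "\<exists>j. 3 * n = 1 + (6 * r + 1) * j" ..
  qed
  then show "trisect (fps_X * geom (6 * r + 1)) $ n = (fps_X ^ (4 * r + 1) * geom (6 * r + 1)) $ n"
    using X_power_geom_nth[of 1] by (simp only: trisect_nth X_power_geom_nth power_one_right)
qed

text \<open>As 6r + 5 is 2 modulo 3 and 6r + 6 is a multiple of 3, exactly the steps k = 3j
  survive.\<close>

lemma trisect_geom_5: "trisect (fps_X ^ (6 * r + 6) * geom (6 * r + 5)) = fps_X ^ (2 * r + 2) * geom (6 * r + 5)"
proof (rule fps_ext)
  fix n
  have "(\<exists>j. 3 * n = 6 * r + 6 + (6 * r + 5) * j) \<longleftrightarrow> (\<exists>j. n = 2 * r + 2 + (6 * r + 5) * j)"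
  proof
    assume "\<exists>j. 3 * n = 6 * r + 6 + (6 * r + 5) * j"
    then obtain k where k: "3 * n = 6 * r + 6 + (6 * r + 5) * k" by blast
    then have "3 * n = 6 * r + 6 + 5 * k + 6 * (r * k)" by (simp add: algebra_simps)
    then have "3 dvd k" by presburger
    then obtain j where "k = 3 * j" by (elim dvdE)
    then have "n = 2 * r + 2 + (6 * r + 5) * j" using k by (simp add: algebra_simps)
    then show "\<exists>j. n = 2 * r + 2 + (6 * r + 5) * j" ..
  next
    assume "\<exists>j. n = 2 * r + 2 + (6 * r + 5) * j"
    then obtain j where "n = 2 * r + 2 + (6 * r + 5) * j" ..
    then have "3 * n = 6 * r + 6 + (6 * r + 5) * (3 * j)" by (simp add: algebra_simps)
    then show "\<exists>j. 3 * n = 6 * r + 6 + (6 * r + 5) * j" ..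
  qed
  then show "trisect (fps_X ^ (6 * r + 6) * geom (6 * r + 5)) $ n = (fps_X ^ (2 * r + 2) * geom (6 * r + 5)) $ n"
    by (simp only: trisect_nth X_power_geom_nth)
qed

lemma X_power_mult_6:
  "fps_X * (fps_X ^ 6) ^ r = (fps_X ^ (6 * r + 1) :: int fps)"
  "fps_X ^ 5 * (fps_X ^ 6) ^ r = (fps_X ^ (6 * r + 5) :: int fps)"
  by (simp_all only: power_mult[symmetric] power_add power_one_right mult.commute)

text \<open>The index shift turns the exponent into 1 + 6(n^2+n): apart from one factor q, this is
  the weight of Bailey's lemma for Q = q^6.\<close>

lemma xi_term_eq:
  "xi_term (Suc n) = fps_X * ((fps_X ^ 6) ^ (n\<^sup>2 + n) * (\<Prod>k\<le>n. geom (6 * k + 1) * geom (6 * k + 5)))"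
proof -
  let ?P = "\<Prod>k\<le>n. geom (6 * k + 1) * geom (6 * k + 5)"
  have "xi_denom (Suc n) * ?P =
      (\<Prod>k\<le>n. ((1 - fps_X ^ (6 * k + 1)) * geom (6 * k + 1)) * ((1 - fps_X ^ (6 * k + 5)) * geom (6 * k + 5)))"
    unfolding xi_denom_def qpoch_def lessThan_Suc_atMost prod.distrib[symmetric]
    by (intro prod.cong refl) (simp only: X_power_mult_6 ac_simps)
  also have "\<dots> = 1" by (simp only: geom_inverse_6 mult_1 prod.neutral_const)
  finally have P: "xi_denom (Suc n) * ?P = 1" .
  have "fps_left_inverse (xi_denom (Suc n)) 1 = (xi_denom (Suc n) * fps_left_inverse (xi_denom (Suc n)) 1) * ?P"
    using arg_cong[OF P, of "\<lambda>f. fps_left_inverse (xi_denom (Suc n)) 1 * f"] by (simp only: ac_simps mult_1_right mult_1)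
  then have "fps_left_inverse (xi_denom (Suc n)) 1 = ?P"
    unfolding xi_denom_inverse by simp
  moreover have "fps_X ^ (6 * (Suc n)\<^sup>2 - 6 * Suc n + 1) = (fps_X::int fps) * (fps_X ^ 6) ^ (n\<^sup>2 + n)"
  proof -
    have "6 * (Suc n)\<^sup>2 - 6 * Suc n + 1 = 1 + 6 * (n\<^sup>2 + n)"
      by (simp add: power2_eq_square algebra_simps)
    then show ?thesis by (simp only: power_add power_mult power_one_right)
  qed
  ultimately show ?thesis by (simp only: xi_term_def mult.assoc)
qed

lemma p_xi_partial_sum:
  assumes "k \<le> K"
  shows "p_xi k = of_bool (k = 0) + 2 * (\<Sum>n<K. xi_term (Suc n)) $ k"
proof -
  let ?S = "Abs_fps (\<lambda>k. \<Sum>i<k. xi_term (Suc i) $ k)"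
  have z: "xi_term (Suc i) $ j = 0" if "j \<le> i" for i j
  proof -
    have "j < 6 * (Suc i)\<^sup>2 - 6 * Suc i + 1"
      using that by (simp add: power2_eq_square)
    then show ?thesis
      unfolding xi_term_def by (subst fps_X_power_mult_nth) simp
  qed
  have eq: "(\<Sum>i<n. xi_term (Suc i)) $ j = ?S $ j" if "j \<le> n" for n j
    unfolding fps_sum_nth fps_nth_Abs_fps
    by (rule sum.mono_neutral_right) (use that z in auto)
  have "(\<lambda>n. xi_term (Suc n)) sums ?S"
    unfolding sums_def
    by (rule tendsto_fpsI, rule eventually_mono[OF eventually_ge_at_top], rule eq)
  then have "(\<Sum>n. xi_term (Suc n)) = ?S" by (rule sums_unique[symmetric])
  then have xi: "xi = 1 + 2 * ?S" by (simp add: xi_def)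
  have "p_xi k = (1::int fps) $ k + 2 * ?S $ k"
    unfolding p_xi_def xi by (simp only: fps_add_nth mult_2)
  then show ?thesis
    unfolding eq[OF assms, symmetric] by simp
qed

text \<open>The trisection of the r-th summand on the \<alpha> side of Bailey's lemma, including the
  extra factor q.\<close>

definition lambert_term :: "nat \<Rightarrow> int fps" where
  "lambert_term r = (-1) ^ r * fps_X ^ (3 * (r\<^sup>2 + r)) *
     (fps_X ^ (4 * r + 1) * geom (6 * r + 1) + fps_X ^ (2 * r + 2) * geom (6 * r + 5))"

text \<open>The summands of (q^2;q^2)_inf, the sum of (-1)^k q^(k(3k+1)) over all integers k, paired
  as k = r and k = -(r+1).\<close>

definition pentagonal_term :: "nat \<Rightarrow> int fps" where
  "pentagonal_term r = (-1) ^ r * (fps_X ^ (3 * r\<^sup>2 + r) - fps_X ^ (3 * r\<^sup>2 + 5 * r + 2))"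

lemma xi_terms_trisect:
  assumes "N < K"
  shows "(\<Sum>n<K. xi_term (Suc n)) $ (3 * N) = (qinv 2 K * (\<Sum>r<K. lambert_term r)) $ N"
proof -
  interpret q_inverses "fps_X ^ 6 :: int fps" "qinv 6" by (rule q_inverses_qinv) simp
  define p where "p = (\<lambda>r. geom (6 * r + 1) * geom (6 * r + 5))"
  define \<alpha> where "\<alpha> = (\<lambda>r. (-1) ^ r * (fps_X ^ 6) ^ (Suc r choose 2) * (1 - (fps_X ^ 6) ^ (2 * r + 1)) * p r)"
  have p: "(1 - fps_X * (fps_X ^ 6) ^ r) * (1 - fps_X ^ 5 * (fps_X ^ 6) ^ r) * p r = 1" for r
  proof -
    have "(1 - fps_X * (fps_X ^ 6) ^ r) * (1 - fps_X ^ 5 * (fps_X ^ 6) ^ r) * p r =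
       ((1 - fps_X ^ (6 * r + 1)) * geom (6 * r + 1)) * ((1 - fps_X ^ (6 * r + 5)) * geom (6 * r + 5))"
      unfolding p_def X_power_mult_6 by (simp only: ac_simps)
    then show ?thesis by (simp only: geom_inverse_6 mult_1)
  qed
  have b: "bailey \<alpha> n = (\<Prod>k\<le>n. p k)" for n
    unfolding \<alpha>_def by (rule bailey_partial_fractions[OF _ p]) (simp flip: power_Suc)
  let ?R = "\<Sum>r<K. (fps_X ^ 6) ^ (r\<^sup>2 + r) * \<alpha> r"
  have "(\<Sum>n<K. xi_term (Suc n)) = fps_X * (\<Sum>n<K. (fps_X ^ 6) ^ (n\<^sup>2 + n) * bailey \<alpha> n)"
    by (simp only: xi_term_eq b p_def sum_distrib_left)
  then have "(\<Sum>n<K. xi_term (Suc n)) - qinv 6 K * (fps_X * ?R) =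
      fps_X * ((\<Sum>n<K. (fps_X ^ 6) ^ (n\<^sup>2 + n) * bailey \<alpha> n) - qinv 6 K * ?R)"
    by (simp only: right_diff_distrib mult.left_commute)
  moreover have "(fps_X ^ 6) ^ K dvd (fps_X :: int fps) * ((\<Sum>n<K. (fps_X ^ 6) ^ (n\<^sup>2 + n) * bailey \<alpha> n) - qinv 6 K * ?R)"
    by (rule dvd_mult[OF bailey_limit])
  ultimately have "fps_X ^ (6 * K) dvd (\<Sum>n<K. xi_term (Suc n)) - qinv 6 K * (fps_X * ?R)"
    by (simp only: power_mult)
  then obtain g where g: "(\<Sum>n<K. xi_term (Suc n)) - qinv 6 K * (fps_X * ?R) = fps_X ^ (6 * K) * g"
    by (rule dvdE)
  have lambert_term: "trisect (fps_X * ((fps_X ^ 6) ^ (r\<^sup>2 + r) * \<alpha> r)) = lambert_term r" for r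
  proof -
    let ?u = "fps_X ^ (6 * r + 1) :: int fps" and ?v = "fps_X ^ (6 * r + 5) :: int fps"
    have uv: "(fps_X ^ 6) ^ (2 * r + 1) = ?u * ?v"
      by (simp only: power_mult[symmetric] power_add[symmetric]) simp
    \<comment> \<open>From 1 - uv = (1-v) + v(1-u): the product of two geometric series becomes a
      sum of single ones, whose exponents divisible by 3 are visible.\<close>
    have "(1 - ?u * ?v) * p r = ((1 - ?v) * geom (6 * r + 5)) * geom (6 * r + 1)
        + ?v * ((1 - ?u) * geom (6 * r + 1)) * geom (6 * r + 5)"
      unfolding p_def by (simp add: algebra_simps)
    then have up: "(1 - ?u * ?v) * p r = geom (6 * r + 1) + ?v * geom (6 * r + 5)"
      by (simp only: geom_inverse_6 mult_1 mult_1_right)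
    \<comment> \<open>The accumulated exponent 9(r^2+r) is a multiple of 3, so this power passes
      through the trisection.\<close>
    have ex: "6 * (r\<^sup>2 + r) + 6 * (Suc r choose 2) = 3 * (3 * (r\<^sup>2 + r))"
    proof -
      have "2 * (Suc r choose 2) = r\<^sup>2 + r"
        by (simp add: choose_two power2_eq_square)
      then show ?thesis by simp
    qed
    have "fps_X * ((fps_X ^ 6) ^ (r\<^sup>2 + r) * \<alpha> r) =
      (-1) ^ r * (((fps_X ^ 6) ^ (r\<^sup>2 + r) * (fps_X ^ 6) ^ (Suc r choose 2)) * (fps_X * ((1 - ?u * ?v) * p r)))"
      unfolding \<alpha>_def uv by (simp only: ac_simps)
    also have "(fps_X ^ 6) ^ (r\<^sup>2 + r) * (fps_X ^ 6) ^ (Suc r choose 2) = (fps_X::int fps) ^ (3 * (3 * (r\<^sup>2 + r)))"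
      unfolding power_mult[symmetric] power_add[symmetric] ex ..
    also have "fps_X * ((1 - ?u * ?v) * p r) = fps_X * geom (6 * r + 1) + fps_X ^ (6 * r + 6) * geom (6 * r + 5)"
      unfolding up by (simp add: distrib_left mult.assoc numeral_eq_Suc)
    finally show ?thesis
      by (simp only: trisect_uminus_power trisect_X_power trisect_add trisect_geom_1 trisect_geom_5 lambert_term_def mult.assoc)
  qed
  \<comment> \<open>The error is a multiple of q^(6K), beyond the degree 3N.\<close>
  have "((\<Sum>n<K. xi_term (Suc n)) - qinv 6 K * (fps_X * ?R)) $ (3 * N) = 0"
    unfolding g using assms by (simp add: fps_X_power_mult_nth)
  then have "(\<Sum>n<K. xi_term (Suc n)) $ (3 * N) = trisect (qinv 6 K * (fps_X * ?R)) $ N"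
    by simp
  also have "trisect (qinv 6 K * (fps_X * ?R)) = qinv 2 K * (\<Sum>r<K. trisect (fps_X * ((fps_X ^ 6) ^ (r\<^sup>2 + r) * \<alpha> r)))"
    by (simp only: trisect_qinv sum_distrib_left trisect_sum)
  finally show ?thesis unfolding lambert_term .
qed

text \<open>For the unit pair at Q = q^2 the left side in \<open>bailey_limit\<close> collapses to
  1, which gives Euler's theorem in truncated form. An arbitrary factor f is harmless because the
  error is a multiple of q^(2K).\<close>

lemma pentagonal:
  assumes "N < K"
  shows "((1 - qinv 2 K * (\<Sum>r<K. pentagonal_term r)) * f) $ N = 0"
proof -
  interpret q_inverses "fps_X ^ 2 :: int fps" "qinv 2" by (rule q_inverses_qinv) simp
  define \<alpha> where "\<alpha> = (\<lambda>r. (-1) ^ r * (fps_X ^ 2) ^ (r choose 2) * (1 - (fps_X ^ 2) ^ (2 * r + 1)) :: int fps)"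
  have "(\<Sum>n<K. (fps_X ^ 2) ^ (n\<^sup>2 + n) * bailey \<alpha> n) = (\<Sum>n<K. if n = 0 then 1 else 0)"
    unfolding \<alpha>_def bailey_unit by (intro sum.cong) auto
  also have "\<dots> = 1" using assms by simp
  finally have 1: "(\<Sum>n<K. (fps_X ^ 2) ^ (n\<^sup>2 + n) * bailey \<alpha> n) = 1" .
  have 2: "(fps_X ^ 2) ^ (r\<^sup>2 + r) * \<alpha> r = pentagonal_term r" for r
  proof -
    have "r * (r - 1) = r\<^sup>2 - r" by (simp add: power2_eq_square algebra_simps)
    then have "2 * (r choose 2) = r\<^sup>2 - r"
      by (simp add: choose_two)
    moreover have "r \<le> r\<^sup>2" by (simp add: power2_nat_le_imp_le self_le_power le_square power2_eq_square)
    ultimately have "2 * (r\<^sup>2 + r) + 2 * (r choose 2) = 3 * r\<^sup>2 + r" by simp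
    then have *: "(fps_X ^ 2) ^ (r\<^sup>2 + r) * (fps_X ^ 2) ^ (r choose 2) = (fps_X :: int fps) ^ (3 * r\<^sup>2 + r)"
      by (simp only: power_mult[symmetric] power_add[symmetric])
    have "(fps_X ^ 2) ^ (r\<^sup>2 + r) * \<alpha> r = (-1) ^ r * (fps_X ^ (3 * r\<^sup>2 + r) * (1 - (fps_X ^ 2) ^ (2 * r + 1)))"
      unfolding \<alpha>_def *[symmetric] by (simp only: ac_simps)
    also have "(fps_X ^ 2) ^ (2 * r + 1) = (fps_X :: int fps) ^ (4 * r + 2)"
      by (simp only: power_mult[symmetric]) (simp add: power2_eq_square)
    also have "fps_X ^ (3 * r\<^sup>2 + r) * (1 - fps_X ^ (4 * r + 2)) = (fps_X ^ (3 * r\<^sup>2 + r) - fps_X ^ (3 * r\<^sup>2 + 5 * r + 2) :: int fps)"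
      by (simp only: right_diff_distrib power_add[symmetric] mult_1_right) (simp add: add.commute add.left_commute)
    finally show ?thesis by (simp add: pentagonal_term_def)
  qed
  have "(fps_X ^ 2) ^ K dvd (1 - qinv 2 K * (\<Sum>r<K. pentagonal_term r)) * f"
    using bailey_limit[of K \<alpha>] unfolding 1 2 by (rule dvd_mult2)
  then obtain g where "(1 - qinv 2 K * (\<Sum>r<K. pentagonal_term r)) * f = fps_X ^ (2 * K) * g"
    unfolding power_mult[symmetric] by (rule dvdE)
  then show ?thesis using assms by (simp add: fps_X_power_mult_nth)
qed

section \<open>Comparison of parities\<close>

lemma even_signed_sum_minus_card:
  assumes "finite A"
  shows "even ((\<Sum>r\<in>A. (-1) ^ r * of_bool (P r)) - int (card {r \<in> A. P r}))"
  using assms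
proof (induction A rule: finite_induct)
  case (insert a A)
  have "card {r \<in> insert a A. P r} = of_bool (P a) + card {r \<in> A. P r}"
  proof (cases "P a")
    case True
    then have "{r \<in> insert a A. P r} = insert a {r \<in> A. P r}" by auto
    then show ?thesis using insert.hyps True by simp
  next
    case False
    then have "{r \<in> insert a A. P r} = {r \<in> A. P r}" by auto
    then show ?thesis using False by simp
  qed
  moreover have "even ((-1) ^ a * of_bool (P a) - (of_bool (P a) :: int))"
    by (cases "P a"; cases "even a") simp_all
  ultimately show ?case
    using insert by simp
qed simp

text \<open>The equation for N says 12N + 1 = d(d + 12(j+1)) with d = 6r + 1. Complementary divisors
  of 12N + 1 agree modulo 12, and j + 1 > 0 accounts for the strict inequality.\<close>

lemma card_divisors_1:
  fixes N K :: nat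
  assumes "N < K"
  shows "card {r \<in> {..<K}. \<exists>j. N = 3 * (r\<^sup>2 + r) + (4 * r + 1) + (6 * r + 1) * j}
    = card {d. d dvd (12 * N + 1) \<and> d mod 6 = 1 \<and> d\<^sup>2 < 12 * N + 1}" (is "card ?A = card ?B")
proof -
  have "(\<lambda>r. 6 * r + 1) ` ?A = ?B"
  proof (intro equalityI subsetI)
    fix d assume "d \<in> (\<lambda>r. 6 * r + 1) ` ?A"
    then obtain r j where d: "d = 6 * r + 1" "N = 3 * (r\<^sup>2 + r) + (4 * r + 1) + (6 * r + 1) * j" by blast
    have e: "12 * N + 1 = d * (d + 12 * (j + 1))"
      unfolding d by (simp add: power2_eq_square algebra_simps)
    have "d\<^sup>2 < 12 * N + 1"
      unfolding e power2_eq_square by (rule mult_strict_left_mono) (simp_all add: d(1))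
    moreover have "d dvd 12 * N + 1" unfolding e by simp
    moreover have "d mod 6 = 1" unfolding d(1) by presburger
    ultimately show "d \<in> ?B" by simp
  next
    fix d assume "d \<in> ?B"
    then have d: "d dvd 12 * N + 1" "d mod 6 = 1" "d\<^sup>2 < 12 * N + 1" by auto
    define r where "r = d div 6"
    have r: "d = 6 * r + 1" unfolding r_def using d(2) by presburger
    obtain e where e: "12 * N + 1 = d * e" using d(1) unfolding dvd_def by blast
    have "d < e" using d(3) unfolding e by (simp add: power2_eq_square)
    have "odd (12 * N + 1)" by simp
    then have "odd e" unfolding e by simp
    then obtain f where f: "e = 2 * f + 1" by (elim oddE)
    have "int (12 * N + 1) = int ((6 * r + 1) * (2 * f + 1))"
      using e unfolding r f by (rule arg_cong)
    then have *: "12 * int N + 1 = (6 * int r + 1) * (2 * int f + 1)"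
      by (simp only: of_nat_add of_nat_mult of_nat_numeral of_nat_1)
    \<comment> \<open>Naming the product r f makes the relation linear. The number i below is (e -
      d)/12, hence at least 1.\<close>
    define q where "q = int r * int f"
    define i where "i = int N - q - int r"
    have "12 * int N + 1 = 12 * q + 6 * int r + 2 * int f + 1"
      unfolding * q_def by (simp add: algebra_simps)
    then have i: "int f = 3 * int r + 6 * i" unfolding i_def by presburger
    have "i \<ge> 1" using \<open>d < e\<close> i unfolding r f by linarith
    define j where "j = nat (i - 1)"
    have j: "i = int j + 1" unfolding j_def using \<open>i \<ge> 1\<close> by simp
    have fe: "f = 3 * r + 6 * j + 6" using i j by linarith
    have N: "N = 3 * (r\<^sup>2 + r) + (4 * r + 1) + (6 * r + 1) * j"
      using e unfolding r f fe by (simp add: power2_eq_square algebra_simps)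
    moreover have "r \<le> N" unfolding N by simp
    ultimately have "r \<in> ?A" using assms by auto
    then show "d \<in> (\<lambda>r. 6 * r + 1) ` ?A" unfolding r by blast
  qed
  then have "card ?B = card ((\<lambda>r. 6 * r + 1) ` ?A)" by (rule arg_cong[OF sym])
  also have "\<dots> = card ?A" by (rule card_image) (simp add: inj_on_def)
  finally show ?thesis by (rule sym)
qed

text \<open>Here 12N + 1 = d(d + 12j) with d = 6r + 5; the value j = 0 is allowed, so a square root
  of 12N + 1 is included.\<close>

lemma card_divisors_5:
  fixes N K :: nat
  assumes "N < K"
  shows "card {r \<in> {..<K}. \<exists>j. N = 3 * (r\<^sup>2 + r) + (2 * r + 2) + (6 * r + 5) * j}
    = card {d. d dvd (12 * N + 1) \<and> d mod 6 = 5 \<and> d\<^sup>2 \<le> 12 * N + 1}" (is "card ?A = card ?B")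
proof -
  have "(\<lambda>r. 6 * r + 5) ` ?A = ?B"
  proof (intro equalityI subsetI)
    fix d assume "d \<in> (\<lambda>r. 6 * r + 5) ` ?A"
    then obtain r j where d: "d = 6 * r + 5" "N = 3 * (r\<^sup>2 + r) + (2 * r + 2) + (6 * r + 5) * j" by blast
    have e: "12 * N + 1 = d * (d + 12 * j)"
      unfolding d by (simp add: power2_eq_square algebra_simps)
    have "d\<^sup>2 \<le> 12 * N + 1"
      unfolding e power2_eq_square by (rule mult_le_mono2) simp
    moreover have "d dvd 12 * N + 1" unfolding e by simp
    moreover have "d mod 6 = 5" unfolding d(1) by presburger
    ultimately show "d \<in> ?B" by simp
  next
    fix d assume "d \<in> ?B"
    then have d: "d dvd 12 * N + 1" "d mod 6 = 5" "d\<^sup>2 \<le> 12 * N + 1" by auto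
    define r where "r = d div 6"
    have r: "d = 6 * r + 5" unfolding r_def using d(2) by presburger
    obtain e where e: "12 * N + 1 = d * e" using d(1) unfolding dvd_def by blast
    have "d \<le> e" using d(3) r unfolding e by (simp add: power2_eq_square)
    have "odd (12 * N + 1)" by simp
    then have "odd e" unfolding e by simp
    then obtain f where f: "e = 2 * f + 1" by (elim oddE)
    have "int (12 * N + 1) = int ((6 * r + 5) * (2 * f + 1))"
      using e unfolding r f by (rule arg_cong)
    then have *: "12 * int N + 1 = (6 * int r + 5) * (2 * int f + 1)"
      by (simp only: of_nat_add of_nat_mult of_nat_numeral of_nat_1)
    define q where "q = int r * int f"
    define i where "i = q + int f - int N"
    have "12 * int N + 1 = 12 * q + 6 * int r + 10 * int f + 5"
      unfolding * q_def by (simp add: algebra_simps)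
    then have i: "int f = 3 * int r + 2 + 6 * i" unfolding i_def by presburger
    have "i \<ge> 0" using \<open>d \<le> e\<close> i unfolding r f by linarith
    define j where "j = nat i"
    have j: "i = int j" unfolding j_def using \<open>i \<ge> 0\<close> by simp
    have fe: "f = 3 * r + 2 + 6 * j" using i j by linarith
    have N: "N = 3 * (r\<^sup>2 + r) + (2 * r + 2) + (6 * r + 5) * j"
      using e unfolding r f fe by (simp add: power2_eq_square algebra_simps)
    moreover have "r \<le> N" unfolding N by simp
    ultimately have "r \<in> ?A" using assms by auto
    then show "d \<in> (\<lambda>r. 6 * r + 5) ` ?A" unfolding r by blast
  qed
  then have "card ?B = card ((\<lambda>r. 6 * r + 5) ` ?A)" by (rule arg_cong[OF sym])
  also have "\<dots> = card ?A" by (rule card_image) (simp add: inj_on_def)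
  finally show ?thesis by (rule sym)
qed

text \<open>Modulo 12 a solution x must be 1 or 5 modulo 6, and completing the square matches x = 6r
  + 1 and x = 6r + 5 with the two families of pentagonal exponents.\<close>

lemma card_pentagonal_squares:
  fixes N K :: nat
  assumes "N < K"
  shows "card {r \<in> {..<K}. \<exists>n>0. N = 3 * r\<^sup>2 + r + n\<^sup>2} + card {r \<in> {..<K}. \<exists>n>0. N = 3 * r\<^sup>2 + 5 * r + 2 + n\<^sup>2}
    = card {x::nat. x > 0 \<and> (\<exists>n>0. x\<^sup>2 + 12 * n\<^sup>2 = 12 * N + 1)}" (is "card ?A + card ?B = card ?X")
proof -
  let ?f = "\<lambda>r::nat. 6 * r + 1" and ?g = "\<lambda>r::nat. 6 * r + 5"
  have f: "(6 * r + 1)\<^sup>2 = 12 * (3 * r\<^sup>2 + r) + (1::nat)" for r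
    by (simp add: power2_eq_square algebra_simps)
  have g: "(6 * r + 5)\<^sup>2 = 12 * (3 * r\<^sup>2 + 5 * r + 2) + (1::nat)" for r
    by (simp add: power2_eq_square algebra_simps)
  have "?f ` ?A \<union> ?g ` ?B = ?X"
  proof (intro equalityI subsetI)
    fix x assume "x \<in> ?f ` ?A \<union> ?g ` ?B"
    then consider r n where "x = 6 * r + 1" "n > 0" "N = 3 * r\<^sup>2 + r + n\<^sup>2"
      | r n where "x = 6 * r + 5" "n > 0" "N = 3 * r\<^sup>2 + 5 * r + 2 + n\<^sup>2" by blast
    then show "x \<in> ?X"
    proof cases
      case 1
      then have "x\<^sup>2 + 12 * n\<^sup>2 = 12 * N + 1" unfolding 1(1,3) f by simp
      then show ?thesis using 1 by auto
    next
      case 2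
      then have "x\<^sup>2 + 12 * n\<^sup>2 = 12 * N + 1" unfolding 2(1,3) g by simp
      then show ?thesis using 2 by auto
    qed
  next
    fix x assume "x \<in> ?X"
    then obtain n where n: "n > 0" "x\<^sup>2 + 12 * n\<^sup>2 = 12 * N + 1" by blast
    define r where "r = x div 6"
    have "x mod 6 = 0 \<or> x mod 6 = 1 \<or> x mod 6 = 2 \<or> x mod 6 = 3 \<or> x mod 6 = 4 \<or> x mod 6 = 5" by presburger
    moreover define c where "c = x mod 6"
    ultimately have c: "c = 0 \<or> c = 1 \<or> c = 2 \<or> c = 3 \<or> c = 4 \<or> c = 5" by simp
    have x: "x = 6 * r + c" unfolding r_def c_def by simp
    have "12 * (3 * r\<^sup>2 + r * c + n\<^sup>2) + c\<^sup>2 = 12 * N + 1"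
      using n(2) unfolding x by (simp add: power2_eq_square algebra_simps)
    then have "(12 * (3 * r\<^sup>2 + r * c + n\<^sup>2) + c\<^sup>2) mod 12 = (12 * N + 1) mod 12" by (rule arg_cong)
    then have "c\<^sup>2 mod 12 = 1" unfolding mod_mult_self4 by simp
    then have "c = 1 \<or> c = 5" using c by (elim disjE) simp_all
    then show "x \<in> ?f ` ?A \<union> ?g ` ?B"
    proof
      assume c: "c = 1"
      then have N: "N = 3 * r\<^sup>2 + r + n\<^sup>2" using n(2) unfolding x c f by simp
      moreover have "r \<le> N" unfolding N by simp
      ultimately have "r \<in> ?A" using assms n(1) by auto
      then show ?thesis unfolding x c by blast
    next
      assume c: "c = 5"
      then have N: "N = 3 * r\<^sup>2 + 5 * r + 2 + n\<^sup>2" using n(2) unfolding x c g by simp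
      moreover have "r \<le> N" unfolding N by simp
      ultimately have "r \<in> ?B" using assms n(1) by auto
      then show ?thesis unfolding x c by blast
    qed
  qed
  moreover have "?f ` ?A \<inter> ?g ` ?B = {}"
  proof -
    have "6 * r + 1 \<noteq> 6 * s + (5::nat)" for r s by presburger
    then show ?thesis by blast
  qed
  moreover have "card (?f ` ?A) = card ?A" "card (?g ` ?B) = card ?B"
    by (rule card_image, simp add: inj_on_def)+
  ultimately show ?thesis
    using card_Un_disjoint[of "?f ` ?A" "?g ` ?B"] by simp
qed

definition squares :: "int fps" where
  "squares = Abs_fps (\<lambda>n. of_bool (\<exists>m>0. n = m\<^sup>2))"

lemma X_power_squares_nth: "(fps_X ^ a * squares) $ N = of_bool (\<exists>n>0. N = a + n\<^sup>2)"
proof (cases "N < a")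
  case False
  then have "N - a = n\<^sup>2 \<longleftrightarrow> N = a + n\<^sup>2" for n by auto
  then show ?thesis using False by (simp add: fps_X_power_mult_nth squares_def)
qed (auto simp: fps_X_power_mult_nth)

text \<open>Modulo 2 each signed sum is a cardinality, and the counting lemmas turn the total into
  the even number of \<open>even_representations_plus_divisors\<close>. Every contributing r is at
  most N, so truncation at K loses nothing.\<close>

lemma even_lambert_minus_pentagonal:
  fixes N K :: nat
  assumes "N < K"
  shows "even (((\<Sum>r<K. lambert_term r) - (\<Sum>r<K. pentagonal_term r) * squares) $ N)"
proof -
  have sgn: "((-1) ^ r * f) $ N = (-1) ^ r * f $ N" for r and f :: "int fps"
    by (cases "even r") simp_all
  let ?P1 = "\<lambda>r. \<exists>j. N = 3 * (r\<^sup>2 + r) + (4 * r + 1) + (6 * r + 1) * j"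
  let ?P5 = "\<lambda>r. \<exists>j. N = 3 * (r\<^sup>2 + r) + (2 * r + 2) + (6 * r + 5) * j"
  let ?Q1 = "\<lambda>r. \<exists>n>0. N = 3 * r\<^sup>2 + r + n\<^sup>2"
  let ?Q5 = "\<lambda>r. \<exists>n>0. N = 3 * r\<^sup>2 + 5 * r + 2 + n\<^sup>2"
  let ?s = "\<lambda>P. \<Sum>r<K. (-1) ^ r * (of_bool (P r) :: int)"
  let ?c = "\<lambda>P. int (card {r \<in> {..<K}. P r})"
  have "lambert_term r $ N = (-1) ^ r * of_bool (?P1 r) + (-1) ^ r * of_bool (?P5 r)" for r
    unfolding lambert_term_def distrib_left mult.assoc mult.assoc[of "fps_X ^ _", symmetric] power_add[symmetric]
      fps_add_nth sgn X_power_geom_nth ..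
  then have 1: "(\<Sum>r<K. lambert_term r) $ N = ?s ?P1 + ?s ?P5"
    by (simp only: fps_sum_nth sum.distrib)
  have "(pentagonal_term r * squares) $ N = (-1) ^ r * of_bool (?Q1 r) - (-1) ^ r * of_bool (?Q5 r)" for r
    unfolding pentagonal_term_def right_diff_distrib left_diff_distrib mult.assoc fps_sub_nth sgn X_power_squares_nth ..
  then have 2: "((\<Sum>r<K. pentagonal_term r) * squares) $ N = ?s ?Q1 - ?s ?Q5"
    by (simp only: fps_sum_nth sum_distrib_right sum_subtractf)
  have ev: "even (?s P - ?c P)" for P
    by (rule even_signed_sum_minus_card) simp
  have "(12 * N + 1) mod 12 = 1" by simp
  from even_representations_plus_divisors[OF this, folded card_divisors_1[OF assms] card_divisors_5[OF assms] card_pentagonal_squares[OF assms]]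
  have "even (?c ?Q1 + ?c ?Q5 + ?c ?P1 + ?c ?P5)"
    by (simp only: of_nat_add[symmetric] even_of_nat)
  then show ?thesis
    unfolding fps_sub_nth 1 2 using ev[of ?P1] ev[of ?P5] ev[of ?Q1] ev[of ?Q5] by (simp only: even_diff even_add) blast
qed

lemma even_fps_mult_nth:
  fixes f g :: "int fps"
  assumes "\<And>n. n \<le> N \<Longrightarrow> even (g $ n)"
  shows "even ((f * g) $ N)"
  unfolding fps_mult_nth using assms by (intro dvd_sum) simp

theorem theorem4p1:
  fixes n :: nat
  shows "[p_xi (3 * n) = (if n = 0 then 1 else if (\<exists>m. n = m\<^sup>2) then 2 else 0)] (mod 4)"
proof -
  \<comment> \<open>One truncation for both uses: it reaches degree 3n in the series of \<xi> and
    exceeds n after trisection, also for n = 0.\<close>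
  define K where "K = 3 * n + 1"
  let ?L = "\<Sum>r<K. lambert_term r" and ?P = "\<Sum>r<K. pentagonal_term r"
  define S where "S = (qinv 2 K * ?L) $ n"
  have n: "n < K" "3 * n \<le> K" by (simp_all add: K_def)
  have p: "p_xi (3 * n) = of_bool (n = 0) + 2 * S"
    using p_xi_partial_sum[OF n(2)] xi_terms_trisect[OF n(1)] by (simp add: S_def)
  have "even ((qinv 2 K * (?L - ?P * squares)) $ n)"
    using n(1) by (intro even_fps_mult_nth even_lambert_minus_pentagonal) simp
  \<comment> \<open>The product of \<open>qinv 2 K\<close> and the pentagonal sum is replaced by 1,
    which is exact up to degree n, so S has the parity of the coefficient of the series of
    squares.\<close>
  also have "qinv 2 K * (?L - ?P * squares) = qinv 2 K * ?L + (1 - qinv 2 K * ?P) * squares - squares"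
    by (simp add: algebra_simps)
  also have "\<dots> $ n = S - squares $ n"
    unfolding fps_sub_nth fps_add_nth pentagonal[OF n(1)] S_def by simp
  finally have "even (S - of_bool (\<exists>m>0. n = m\<^sup>2))"
    by (simp add: squares_def)
  then obtain t where t: "S = of_bool (\<exists>m>0. n = m\<^sup>2) + 2 * t" by (metis add.commute diff_add_cancel dvdE)
  have "(\<exists>m>0. n = m\<^sup>2) \<longleftrightarrow> n \<noteq> 0 \<and> (\<exists>m. n = m\<^sup>2)" by (metis not_gr_zero zero_power2 power_eq_0_iff)
  then have "p_xi (3 * n) = (if n = 0 then 1 else if (\<exists>m. n = m\<^sup>2) then 2 else 0) + 4 * t"
    unfolding p t by simp
  then show ?thesis by (simp add: cong_def)
qed

end
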